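(* For every real number $p>1$ and every rational number $q\in\mathbb{Q}$ satisfying $1<2q<\sqrt{2}$, there exists a closed $p$-elastic curve in the hyperbolic plane $\mathbb{H}_0^2$ with nonconstant curvature.
   Context: $\mathbb{L}^3$ is $\mathbb{R}^3$ with the metric $\langle\cdot,\cdot\rangle=dx^2+dy^2-dz^2$. The hyperbolic plane is $\mathbb{H}_0^2=\{(x,y,z)\in\mathbb{R}^3 : x^2+y^2-z^2=-1,\ z>0\}$ with the Riemannian metric induced from $\mathbb{L}^3$ (curvature $-1$) and Levi-Civita connection $\nabla$. Curves are smooth, immersed and parameterized by arc length $s$. With $T=\gamma'$ and $N$ the unit normal such that $\{T,N\}$ is positively oriented, the signed geodesic curvature $\kappa$ is defined by $\nabla_TT=\kappa N$. A $p$-elastic curve in $\mathbb{H}_0^2$ is a curve whose curvature $\kappa$ satisfies $$p\,\frac{d^2}{ds^2}\left(\kappa^{p-1}\right)+(p-1)\kappa^{p+1}-p\,\kappa^{p-1}=0 ;$$ if $p$ is not a natural number, only convex curves ($\kappa>0$ everywhere) are considered. A curve is closed if it is defined on $\mathbb{R}$ and periodic, $\gamma(s+L)=\gamma(s)$ for some $L>0$ and all $s$. *)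

theory Defs
  imports "HOL-Analysis.Analysis"
begin

section \<open>The hyperboloid model in Lorentz-Minkowski space\<close>

definition lorentz :: "real^3 \<Rightarrow> real^3 \<Rightarrow> real" where
  "lorentz v w = v $ 1 * w $ 1 + v $ 2 * w $ 2 - v $ 3 * w $ 3"

definition hyperbolic_plane :: "(real^3) set" where
  "hyperbolic_plane = {x. lorentz x x = -1 \<and> x $ 3 > 0}"

definition tangent_plane :: "real^3 \<Rightarrow> (real^3) set" where
  "tangent_plane x = {v. lorentz v x = 0}"

text \<open>The Lorentz-orthogonal projection onto the tangent plane at a point of the hyperbolic
  plane; see \<open>tangent_part_unique\<close> below.\<close>

definition tangent_part :: "real^3 \<Rightarrow> real^3 \<Rightarrow> real^3" where
  "tangent_part x v = v + lorentz v x *\<^sub>R x"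


section \<open>Curves\<close>

abbreviation vderiv :: "(real \<Rightarrow> real^3) \<Rightarrow> real \<Rightarrow> real^3" where
  "vderiv X \<equiv> (\<lambda>s. vector_derivative X (at s))"

definition smooth_curve :: "(real \<Rightarrow> real^3) \<Rightarrow> bool" where
  "smooth_curve \<gamma> \<longleftrightarrow> (\<forall>n s. (vderiv ^^ n) \<gamma> differentiable (at s))"

text \<open>Only curves defined on the whole real line are considered, since closed curves are.
  Unit speed makes the curve immersed.\<close>

definition unit_speed_curve :: "(real \<Rightarrow> real^3) \<Rightarrow> bool" where
  "unit_speed_curve \<gamma> \<longleftrightarrow> smooth_curve \<gamma> \<and> (\<forall>s. \<gamma> s \<in> hyperbolic_plane) \<and>
     (\<forall>s. lorentz (vderiv \<gamma> s) (vderiv \<gamma> s) = 1)"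

text \<open>The Levi-Civita connection of the metric induced on a submanifold is the tangential
  part of the flat connection of the ambient space (Gauss formula); this is the resulting
  covariant derivative of a tangent field \<open>X\<close> along \<open>\<gamma>\<close>.\<close>

definition covariant_deriv :: "(real \<Rightarrow> real^3) \<Rightarrow> (real \<Rightarrow> real^3) \<Rightarrow> real \<Rightarrow> real^3" where
  "covariant_deriv \<gamma> X s = tangent_part (\<gamma> s) (vderiv X s)"

text \<open>A basis \<open>(v, w)\<close> of the tangent plane at \<open>x\<close> is positive if \<open>(x, v, w)\<close> is positive in
  the ambient space; at \<open>(0, 0, 1)\<close> this is the usual orientation of the first two
  coordinates.\<close>

definition pos_oriented :: "real^3 \<Rightarrow> real^3 \<Rightarrow> real^3 \<Rightarrow> bool" where
  "pos_oriented x v w \<longleftrightarrow> det (vector [x, v, w] :: real^3^3) > 0"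

definition is_unit_normal :: "real^3 \<Rightarrow> real^3 \<Rightarrow> real^3 \<Rightarrow> bool" where
  "is_unit_normal x v n \<longleftrightarrow> n \<in> tangent_plane x \<and> lorentz n n = 1 \<and> lorentz v n = 0 \<and>
     pos_oriented x v n"

definition unit_normal :: "(real \<Rightarrow> real^3) \<Rightarrow> real \<Rightarrow> real^3" where
  "unit_normal \<gamma> s = (THE n. is_unit_normal (\<gamma> s) (vderiv \<gamma> s) n)"

definition geodesic_curvature :: "(real \<Rightarrow> real^3) \<Rightarrow> real \<Rightarrow> real" where
  "geodesic_curvature \<gamma> s =
     (THE k. covariant_deriv \<gamma> (vderiv \<gamma>) s = k *\<^sub>R unit_normal \<gamma> s)"

definition closed_curve :: "(real \<Rightarrow> real^3) \<Rightarrow> bool" where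
  "closed_curve \<gamma> \<longleftrightarrow> (\<exists>L>0. \<forall>s. \<gamma> (s + L) = \<gamma> s)"


section \<open>p-elastic curves\<close>

text \<open>\<open>x powr a\<close> is not the usual power when \<open>x\<close> is negative, or when \<open>x = 0\<close> and \<open>a = 0\<close>,
  so integer exponents are treated separately.\<close>

definition real_pow :: "real \<Rightarrow> real \<Rightarrow> real" where
  "real_pow x a = (if a \<in> \<int> then x powi \<lfloor>a\<rfloor> else x powr a)"

definition p_elastic_curve :: "real \<Rightarrow> (real \<Rightarrow> real^3) \<Rightarrow> bool" where
  "p_elastic_curve p \<gamma> \<longleftrightarrow> unit_speed_curve \<gamma> \<and>
     (p \<notin> \<nat> \<longrightarrow> (\<forall>s. geodesic_curvature \<gamma> s > 0)) \<and>
     (\<forall>s. p * (deriv ^^ 2) (\<lambda>t. real_pow (geodesic_curvature \<gamma> t) (p - 1)) s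
        + (p - 1) * real_pow (geodesic_curvature \<gamma> s) (p + 1)
        - p * real_pow (geodesic_curvature \<gamma> s) (p - 1) = 0)"


section \<open>The definite descriptions above are well defined\<close>

lemma tangent_part_unique:
  assumes "x \<in> hyperbolic_plane"
  shows "w = tangent_part x v \<longleftrightarrow>
    w \<in> tangent_plane x \<and> (\<forall>u \<in> tangent_plane x. lorentz (v - w) u = 0)"
proof -
  have x: "lorentz x x = -1" using assms by (simp add: hyperbolic_plane_def)
  have lin: "lorentz (a + b) c = lorentz a c + lorentz b c"
    "lorentz (a - b) c = lorentz a c - lorentz b c"
    "lorentz (r *\<^sub>R a) c = r * lorentz a c" "lorentz a c = lorentz c a" for a b c r
    by (simp_all add: lorentz_def algebra_simps)
  have t: "tangent_part x v \<in> tangent_plane x"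
    by (simp add: tangent_part_def tangent_plane_def lin(1,3) x)
  have o: "lorentz (v - tangent_part x v) u = 0" if "u \<in> tangent_plane x" for u
  proof -
    have "v - tangent_part x v = (- lorentz v x) *\<^sub>R x" by (simp add: tangent_part_def)
    moreover have "lorentz x u = 0" using that lin(4)[of x u] by (simp add: tangent_plane_def)
    ultimately show ?thesis by (simp only: lin(3) mult_zero_right)
  qed
  have "w = tangent_part x v" if w: "w \<in> tangent_plane x"
    and wo: "\<forall>u \<in> tangent_plane x. lorentz (v - w) u = 0"
  proof -
    define d where "d = tangent_part x v - w"
    have dx: "lorentz d x = 0" using t w by (simp add: d_def tangent_plane_def lin(2))
    have du: "lorentz d u = 0" if "lorentz u x = 0" for u
    proof -
      have "u \<in> tangent_plane x" using that by (simp add: tangent_plane_def)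
      then have "lorentz (v - w) u = 0" "lorentz (v - tangent_part x v) u = 0"
        using wo o by auto
      then show ?thesis by (simp add: d_def lin(2))
    qed
    have "lorentz d u = 0" for u
    proof -
      have "lorentz (u + lorentz u x *\<^sub>R x) x = 0" by (simp add: lin(1,3) x)
      then have "lorentz d (u + lorentz u x *\<^sub>R x) = 0" by (rule du)
      then show ?thesis by (metis add.right_neutral dx lin(1) lin(3) lin(4) mult_zero_right)
    qed
    from this[of "axis 1 1"] this[of "axis 2 1"] this[of "axis 3 1"]
    have "d = 0" by (simp add: lorentz_def axis_def vec_eq_iff forall_3)
    then show ?thesis by (simp add: d_def)
  qed
  then show ?thesis using t o by blast
qed

lemma hyperbolic_frame:
  assumes "lorentz x x = -1" "lorentz v x = 0" "lorentz v v = 1"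
  obtains c where "is_unit_normal x v c"
    "\<And>w. w = (- lorentz w x) *\<^sub>R x + lorentz w v *\<^sub>R v + lorentz w c *\<^sub>R c"
    "\<And>n. is_unit_normal x v n \<Longrightarrow> n = c"
proof -
  define c :: "real^3" where "c = vector [x$2 * v$3 - x$3 * v$2, x$3 * v$1 - x$1 * v$3,
     - (x$1 * v$2 - x$2 * v$1)]"
  have cs: "c$1 = x$2 * v$3 - x$3 * v$2" "c$2 = x$3 * v$1 - x$1 * v$3"
    "c$3 = - (x$1 * v$2 - x$2 * v$1)" by (simp_all add: c_def)
  note as = assms[unfolded lorentz_def]
  have cc: "lorentz c c = 1" using as unfolding lorentz_def cs by algebra
  have cx: "lorentz c x = 0" "lorentz v c = 0" unfolding lorentz_def cs by algebra+
  have dt: "det (vector [x, v, n] :: real^3^3) = lorentz c n" for n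
    unfolding det_3 lorentz_def cs by (simp add: algebra_simps)
  have c: "is_unit_normal x v c"
    by (simp add: is_unit_normal_def tangent_plane_def pos_oriented_def cc cx dt)
  have ex: "w = (- lorentz w x) *\<^sub>R x + lorentz w v *\<^sub>R v + lorentz w c *\<^sub>R c" for w
  proof -
    have "w$1 = - lorentz w x * x$1 + lorentz w v * v$1 + lorentz w c * c$1"
      using as unfolding lorentz_def cs by algebra
    moreover have "w$2 = - lorentz w x * x$2 + lorentz w v * v$2 + lorentz w c * c$2"
      using as unfolding lorentz_def cs by algebra
    moreover have "w$3 = - lorentz w x * x$3 + lorentz w v * v$3 + lorentz w c * c$3"
      using as unfolding lorentz_def cs by algebra
    ultimately show ?thesis by (simp add: vec_eq_iff forall_3)
  qed
  have "n = c" if n: "is_unit_normal x v n" for n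
  proof -
    have l: "lorentz n x = 0" "lorentz n v = 0" "lorentz n n = 1" "lorentz c n > 0"
      using n by (simp_all add: is_unit_normal_def tangent_plane_def pos_oriented_def dt)
        (simp add: lorentz_def algebra_simps)
    define a where "a = lorentz n c"
    have e: "n = a *\<^sub>R c" using ex[of n] l by (simp add: a_def)
    have "lorentz n n = a * a * lorentz c c" "lorentz c n = a * lorentz c c"
      unfolding e lorentz_def by (simp_all add: algebra_simps)
    then have "a * a = 1" "a > 0" using l cc by auto
    then have "a = 1" by (auto simp: square_eq_1_iff)
    then show ?thesis using e by simp
  qed
  with c ex show thesis using that by blast
qed

lemma lorentz_has_derivative:
  assumes "(X has_vector_derivative X') (at s)" "(Y has_vector_derivative Y') (at s)"
  shows "((\<lambda>t. lorentz (X t) (Y t)) has_real_derivative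
    (lorentz X' (Y s) + lorentz (X s) Y')) (at s)"
proof -
  have "((\<lambda>t. X t $ i) has_real_derivative X' $ i) (at s)"
    "((\<lambda>t. Y t $ i) has_real_derivative Y' $ i) (at s)" for i
    using assms by (simp_all add: has_real_derivative_iff_has_vector_derivative
        bounded_linear.has_vector_derivative[OF bounded_linear_vec_nth])
  then show ?thesis unfolding lorentz_def
    by (auto intro!: derivative_eq_intros simp: algebra_simps)
qed

lemma unit_speed_curve_frame:
  assumes "unit_speed_curve \<gamma>"
  shows "is_unit_normal (\<gamma> s) (vderiv \<gamma> s) n \<longleftrightarrow> n = unit_normal \<gamma> s"
    and "covariant_deriv \<gamma> (vderiv \<gamma>) s = k *\<^sub>R unit_normal \<gamma> s \<longleftrightarrow> k = geodesic_curvature \<gamma> s"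
proof -
  have sm: "(vderiv ^^ n) \<gamma> differentiable (at t)" for n t
    using assms by (simp add: unit_speed_curve_def smooth_curve_def)
  have d1: "(\<gamma> has_vector_derivative vderiv \<gamma> t) (at t)" for t
    using sm[of 0 t] by (simp add: vector_derivative_works)
  have d2: "(vderiv \<gamma> has_vector_derivative vderiv (vderiv \<gamma>) t) (at t)" for t
    using sm[of 1 t] by (simp add: vector_derivative_works)
  have g: "lorentz (\<gamma> t) (\<gamma> t) = -1" and T: "lorentz (vderiv \<gamma> t) (vderiv \<gamma> t) = 1" for t
    using assms by (simp_all add: unit_speed_curve_def hyperbolic_plane_def)
  have sym: "lorentz a b = lorentz b a" for a b by (simp add: lorentz_def)
  have "((\<lambda>t. -1) has_real_derivative
      lorentz (vderiv \<gamma> s) (\<gamma> s) + lorentz (\<gamma> s) (vderiv \<gamma> s)) (at s)"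
    using lorentz_has_derivative[OF d1 d1, of s] by (simp add: g)
  from DERIV_unique[OF this DERIV_const] have Tg: "lorentz (vderiv \<gamma> s) (\<gamma> s) = 0"
    by (simp add: sym[of "\<gamma> s"])
  have "((\<lambda>t. 1) has_real_derivative lorentz (vderiv (vderiv \<gamma>) s) (vderiv \<gamma> s)
      + lorentz (vderiv \<gamma> s) (vderiv (vderiv \<gamma>) s)) (at s)"
    using lorentz_has_derivative[OF d2 d2, of s] by (simp add: T)
  from DERIV_unique[OF this DERIV_const]
  have TT: "lorentz (vderiv (vderiv \<gamma>) s) (vderiv \<gamma> s) = 0"
    by (simp add: sym[of "vderiv \<gamma> s"])
  obtain c where c: "is_unit_normal (\<gamma> s) (vderiv \<gamma> s) c"
    and ex: "\<And>w. w = (- lorentz w (\<gamma> s)) *\<^sub>R \<gamma> s + lorentz w (vderiv \<gamma> s) *\<^sub>R vderiv \<gamma> s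
      + lorentz w c *\<^sub>R c"
    and un: "\<And>n. is_unit_normal (\<gamma> s) (vderiv \<gamma> s) n \<Longrightarrow> n = c"
    using hyperbolic_frame[OF g Tg T] by blast
  have N: "unit_normal \<gamma> s = c"
    unfolding unit_normal_def using c un by (rule the_equality)
  show "is_unit_normal (\<gamma> s) (vderiv \<gamma> s) n \<longleftrightarrow> n = unit_normal \<gamma> s"
    using c un N by blast
  have c0: "c \<noteq> 0" using c by (auto simp: is_unit_normal_def lorentz_def)
  have e: "covariant_deriv \<gamma> (vderiv \<gamma>) s = lorentz (vderiv (vderiv \<gamma>) s) c *\<^sub>R c"
    using ex[of "vderiv (vderiv \<gamma>) s"] TT
    by (simp add: covariant_deriv_def tangent_part_def algebra_simps)
  have "geodesic_curvature \<gamma> s = lorentz (vderiv (vderiv \<gamma>) s) c"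
    unfolding geodesic_curvature_def N e using c0 by (intro the_equality) auto
  then show "covariant_deriv \<gamma> (vderiv \<gamma>) s = k *\<^sub>R unit_normal \<gamma> s \<longleftrightarrow>
      k = geodesic_curvature \<gamma> s"
    unfolding N e using c0 by auto
qed

end

theory Submission
  imports Defs
begin

text \<open>
Put \<open>n = p / (p - 1)\<close>. Along a \<open>p\<close>-elastic curve with unit tangent \<open>T\<close> and normal \<open>N\<close> the vector
\<open>p \<kappa>\<^sup>p\<^sup>-\<^sup>1 \<gamma> - p (\<kappa>\<^sup>p\<^sup>-\<^sup>1)' T + (p - 1) \<kappa>\<^sup>p N\<close> of Lorentz space is constant. If it is timelike, it may be
placed on the third axis. Then the height \<open>z = e\<^sup>x\<close> of the curve is a multiple of \<open>\<kappa>\<^sup>p\<^sup>-\<^sup>1\<close>, and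
the curve with polar angle \<open>\<theta>\<close> is described by one parameter \<open>c > 0\<close>:
\<open>z' = z\<^sup>n v\<close>, \<open>v\<^sup>2 = W - c\<^sup>2\<close>, \<open>\<theta>' = c z\<^sup>n / (z\<^sup>2 - 1)\<close> and \<open>\<kappa> = n c z\<^sup>n\<^sup>-\<^sup>1\<close>, where
\<open>W = (z\<^sup>2 - 1) / z\<^sup>2\<^sup>n\<close> rises from 0 at \<open>z = 1\<close> to a maximum \<open>a\<^sup>2\<close> and falls back to 0 at infinity.
Conversely, these equations define a \<open>p\<close>-elastic curve (\<open>elastic_curve_from_profile\<close>).

For \<open>0 < c < a\<close> the height oscillates between the two solutions of \<open>W = c\<^sup>2\<close>. The coordinate
\<open>w = \<plusminus> sqrt (a\<^sup>2 - W)\<close> of the potential well \<open>a\<^sup>2 - W\<close> turns the energy equation into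
\<open>w\<^sup>2 + v\<^sup>2 = \<rho>\<^sup>2\<close> with \<open>\<rho>\<^sup>2 = a\<^sup>2 - c\<^sup>2\<close>, so an orbit is a circle \<open>w = \<rho> sin \<phi>\<close>, \<open>v = \<rho> cos \<phi>\<close>, and
arc length and polar angle are antiderivatives, with respect to \<open>\<phi>\<close>, of explicit periodic
functions (\<open>orbit\<close>). In one period the polar angle grows by
\<open>\<Lambda> \<rho> = c \<integral> Q (\<rho> sin \<phi>) d\<phi>\<close>, the integral being over \<open>[0, 2 \<pi>]\<close>, with a continuous function \<open>Q\<close> on
\<open>(-a, a)\<close> that does not depend on \<open>\<rho>\<close>.

The curve closes up as soon as \<open>\<Lambda> \<rho>\<close> is a rational multiple of \<open>2 \<pi>\<close>. In fact \<open>\<Lambda>\<close> takes the value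
\<open>2 \<pi> q\<close> whenever \<open>1 < 2 q < sqrt 2\<close>, by the intermediate value theorem: \<open>\<Lambda> 0 = sqrt 2 \<pi>\<close>, which is the
limit of small oscillations about a circle (\<open>\<Lambda>_0\<close>), while \<open>\<Lambda>\<close> gets below every number greater than \<open>\<pi>\<close> as
\<open>\<rho> \<rightarrow> a\<close> (\<open>\<Lambda>_small\<close>). For the latter, \<open>(a\<^sup>2 - w\<^sup>2) Q w\<close> tends to \<open>a\<close> at one end of \<open>(-a, a)\<close>, where
the curve approaches the axis, and to 0 at the other, where it is far away; so the even part of \<open>Q\<close>
is nearly \<open>(a / 2) / (a\<^sup>2 - w\<^sup>2)\<close> there, and the integral of \<open>a / (a\<^sup>2 - (\<rho> sin \<phi>)\<^sup>2)\<close> is exactly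
\<open>2 \<pi> / c\<close>.
\<close>


section \<open>Inverse functions and antiderivatives\<close>

text \<open>The function \<open>f\<close> may fail to be surjective, but near \<open>f x\<close> its \<open>inv\<close> is a genuine right inverse, by
the intermediate value theorem on \<open>[x - 1, x + 1]\<close>.\<close>

lemma inv_has_derivative:
  fixes f f' :: "real \<Rightarrow> real"
  assumes d: "\<And>x. (f has_real_derivative f' x) (at x)" and pos: "\<And>x. f' x > 0"
  shows "strict_mono f" and "(inv f has_real_derivative 1 / f' x) (at (f x))"
proof -
  show sm: "strict_mono f"
    by (rule strict_monoI) (metis DERIV_pos_imp_increasing d pos)
  have i: "inv f (f z) = z" for z
    using sm by (simp add: strict_mono_imp_inj_on)
  have c: "isCont f z" for z using d DERIV_isCont by blast
  have "isCont (inv f) (f x)"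
    by (rule isCont_inverse_function[of 1]) (auto simp: i c)
  moreover have "f (inv f y) = y" if "f (x - 1) < y" "y < f (x + 1)" for y
  proof -
    have "continuous_on {x - 1..x + 1} f" using c by (simp add: continuous_at_imp_continuous_on)
    then have "\<exists>t\<ge>x - 1. t \<le> x + 1 \<and> f t = y" using that by (intro IVT') auto
    then show ?thesis using i by auto
  qed
  ultimately have "(inv f has_real_derivative inverse (f' x)) (at (f x))"
    using d pos[of x] sm
    by (intro DERIV_inverse_function[where f = f and a = "f (x - 1)" and b = "f (x + 1)"])
       (simp_all add: i strict_mono_less)
  then show "(inv f has_real_derivative 1 / f' x) (at (f x))"
    by (simp add: inverse_eq_divide)
qed

lemma has_integral_antiderivative:
  fixes F f :: "real \<Rightarrow> real"
  assumes "\<And>x. (F has_real_derivative f x) (at x)" "a \<le> b"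
  shows "(f has_integral F b - F a) {a..b}"
  using assms by (intro fundamental_theorem_of_calculus)
    (auto intro: has_vector_derivative_at_within simp: has_real_derivative_iff_has_vector_derivative)

text \<open>The antiderivative \<open>F\<close> is periodic up to a constant because \<open>F (x + P) - F x\<close> has derivative 0.\<close>

lemma periodic_antiderivative:
  fixes f :: "real \<Rightarrow> real"
  assumes "\<And>x. isCont f x" and per: "\<And>x. f (x + P) = f x" and P: "P > 0"
  obtains F where "\<And>x. (F has_real_derivative f x) (at x)"
    and "\<And>x. F (x + P) = F x + integral {0..P} f"
proof -
  obtain F where "\<forall>x::real. - \<infinity> < ereal x \<longrightarrow> ereal x < \<infinity> \<longrightarrow> (F has_vector_derivative f x) (at x)"
    using einterval_antiderivative[of "- \<infinity>" "\<infinity>" f] assms(1) by auto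
  then have F: "(F has_real_derivative f x) (at x)" for x
    by (simp add: has_real_derivative_iff_has_vector_derivative)
  have "((\<lambda>x. F (x + P) - F x) has_real_derivative 0) (at x)" for x
    using DERIV_diff[OF DERIV_shift[THEN iffD1, OF F[of "x + P"]] F[of x]] per by simp
  then have "F (x + P) - F x = F (0 + P) - F 0" for x
    using DERIV_isconst_all by blast
  moreover have "(f has_integral F P - F 0) {0..P}"
    using P by (intro has_integral_antiderivative F) simp
  ultimately show thesis
    using that[OF F] by (metis add.commute add_0 diff_add_cancel integral_unique)
qed

text \<open>Iterating the shift makes \<open>f\<close> unbounded in both directions, and its range is connected.\<close>

lemma quasi_periodic_surj:
  fixes f :: "real \<Rightarrow> real"
  assumes c: "\<And>x. isCont f x" and P: "\<And>x. f (x + P) = f x + L" and L: "L > 0"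
  shows "surj f"
proof -
  have up: "f (x + of_nat k * P) = f x + of_nat k * L" for x k
  proof (induction k)
    case (Suc k)
    then show ?case using P[of "x + of_nat k * P"] by (simp add: algebra_simps)
  qed simp
  have "\<exists>x. f x = y" for y
  proof -
    obtain k where k: "\<bar>y - f 0\<bar> < of_nat k * L"
      using L reals_Archimedean3 by blast
    have "f (- (of_nat k * P)) + of_nat k * L = f 0"
      using up[of "- (of_nat k * P)" k] by simp
    then have "f (- (of_nat k * P)) \<le> y" "y \<le> f (of_nat k * P)"
      using k up[of 0 k] by auto
    moreover have "connected (range f)"
      using c by (intro connected_continuous_image continuous_at_imp_continuous_on) auto
    ultimately have "y \<in> range f"
      by (meson connectedD_interval rangeI)
    then show ?thesis by auto
  qed
  then show ?thesis by (metis surj_def)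
qed


section \<open>The square root coordinate of a potential well\<close>

text \<open>A potential with a single nondegenerate minimum, of value 0, has the form \<open>V = m\<^sup>2\<close> with a
coordinate \<open>m\<close> of class \<open>C\<^sup>1\<close> and with positive derivative: the Morse lemma in one variable. It is in this
coordinate that the level sets of the energy \<open>V + v\<^sup>2\<close> are circles.\<close>

locale potential_well =
  fixes V V' :: "real \<Rightarrow> real" and x\<^sub>0 D :: real
  assumes V_deriv: "\<And>x. (V has_real_derivative V' x) (at x)"
    and V'_cont: "\<And>x. isCont V' x"
    and V'_deriv: "(V' has_real_derivative D) (at x\<^sub>0)"
    and V_x0: "V x\<^sub>0 = 0"
    and V'_neg: "\<And>x. x < x\<^sub>0 \<Longrightarrow> V' x < 0"
    and V'_pos: "\<And>x. x > x\<^sub>0 \<Longrightarrow> V' x > 0"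
    and D_pos: "D > 0"
begin

definition m :: "real \<Rightarrow> real" where
  "m x = (if x < x\<^sub>0 then - sqrt (V x) else sqrt (V x))"

definition m' :: "real \<Rightarrow> real" where
  "m' x = (if x = x\<^sub>0 then sqrt (D / 2) else V' x / (2 * m x))"

lemma V_pos: "x \<noteq> x\<^sub>0 \<Longrightarrow> V x > 0"
proof (cases x x\<^sub>0 rule: linorder_cases)
  case less
  then show ?thesis
    using DERIV_neg_imp_decreasing_open[of x x\<^sub>0 V] V_deriv V'_neg V_x0
    by (metis DERIV_isCont continuous_at_imp_continuous_on)
next
  case greater
  then show ?thesis
    using DERIV_pos_imp_increasing_open[of x\<^sub>0 x V] V_deriv V'_pos V_x0
    by (metis DERIV_isCont continuous_at_imp_continuous_on)
qed simp

lemma m_square: "(m x)\<^sup>2 = V x"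
  using V_pos[of x] V_x0 by (cases "x = x\<^sub>0") (auto simp: m_def)

lemma V'_x0: "V' x\<^sub>0 = 0"
proof (rule DERIV_local_min[OF V_deriv, of 1])
  show "\<forall>y. \<bar>x\<^sub>0 - y\<bar> < 1 \<longrightarrow> V x\<^sub>0 \<le> V y"
    using V_pos V_x0 by (metis less_eq_real_def order_refl)
qed simp

lemma V'_quotient: "((\<lambda>x. V' x / (x - x\<^sub>0)) \<longlongrightarrow> D) (at x\<^sub>0)"
  using V'_deriv by (simp add: has_field_derivative_iff V'_x0)

text \<open>Since \<open>m\<close> vanishes at \<open>x\<^sub>0\<close>, this is its derivative there; it exists because
\<open>V x / (x - x\<^sub>0)\<^sup>2 \<rightarrow> D / 2\<close> by l'Hopital's rule.\<close>

lemma m_quotient: "((\<lambda>x. m x / (x - x\<^sub>0)) \<longlongrightarrow> sqrt (D / 2)) (at x\<^sub>0)"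
proof -
  have "((\<lambda>x. V x / (x - x\<^sub>0)\<^sup>2) \<longlongrightarrow> D / 2) (at x\<^sub>0)"
  proof (rule lhopital)
    show "(V \<longlongrightarrow> 0) (at x\<^sub>0)"
      using DERIV_isCont[OF V_deriv[of x\<^sub>0]] V_x0 by (simp add: isCont_def)
    show "((\<lambda>x. (x - x\<^sub>0)\<^sup>2) \<longlongrightarrow> 0) (at x\<^sub>0)"
      by (auto intro!: tendsto_eq_intros)
    have ne: "\<forall>\<^sub>F x in at x\<^sub>0. x \<noteq> x\<^sub>0" by (simp add: eventually_at_filter)
    show "\<forall>\<^sub>F x in at x\<^sub>0. (x - x\<^sub>0)\<^sup>2 \<noteq> 0" "\<forall>\<^sub>F x in at x\<^sub>0. 2 * (x - x\<^sub>0) \<noteq> 0"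
      using ne by (auto elim!: eventually_mono)
    show "\<forall>\<^sub>F x in at x\<^sub>0. (V has_real_derivative V' x) (at x)" by (simp add: V_deriv)
    show "\<forall>\<^sub>F x in at x\<^sub>0. ((\<lambda>x. (x - x\<^sub>0)\<^sup>2) has_real_derivative 2 * (x - x\<^sub>0)) (at x)"
      by (intro always_eventually allI) (auto intro!: derivative_eq_intros)
    show "((\<lambda>x. V' x / (2 * (x - x\<^sub>0))) \<longlongrightarrow> D / 2) (at x\<^sub>0)"
      using tendsto_mult[OF tendsto_const[of "1/2"] V'_quotient] by (simp add: field_simps)
  qed
  then have "((\<lambda>x. sqrt (V x / (x - x\<^sub>0)\<^sup>2)) \<longlongrightarrow> sqrt (D / 2)) (at x\<^sub>0)"
    by (rule tendsto_real_sqrt)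
  then show ?thesis
  proof (rule Lim_transform_eventually)
    show "\<forall>\<^sub>F x in at x\<^sub>0. sqrt (V x / (x - x\<^sub>0)\<^sup>2) = m x / (x - x\<^sub>0)"
      unfolding eventually_at_filter
      by (intro always_eventually allI impI) (auto simp: m_def real_sqrt_divide field_simps)
  qed
qed

lemma m_deriv: "(m has_real_derivative m' x) (at x)"
proof (cases x x\<^sub>0 rule: linorder_cases)
  case less
  have "((\<lambda>x. - sqrt (V x)) has_real_derivative m' x) (at x)"
    using V_pos[of x] less
    by (auto intro!: derivative_eq_intros V_deriv simp: m'_def m_def field_simps)
  moreover have "\<forall>\<^sub>F t in nhds x. m t = - sqrt (V t)"
    using eventually_nhds_in_open[of "{..<x\<^sub>0}" x] less
    by (auto simp: m_def elim!: eventually_mono)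
  ultimately show ?thesis by (subst DERIV_cong_ev) auto
next
  case equal
  have "m x\<^sub>0 = 0" using V_x0 by (simp add: m_def)
  then show ?thesis using m_quotient equal
    by (simp add: has_field_derivative_iff m'_def)
next
  case greater
  have "((\<lambda>x. sqrt (V x)) has_real_derivative m' x) (at x)"
    using V_pos[of x] greater
    by (auto intro!: derivative_eq_intros V_deriv simp: m'_def m_def field_simps)
  moreover have "\<forall>\<^sub>F t in nhds x. m t = sqrt (V t)"
    using eventually_nhds_in_open[of "{x\<^sub>0<..}" x] greater
    by (auto simp: m_def elim!: eventually_mono)
  ultimately show ?thesis by (subst DERIV_cong_ev) auto
qed

lemma m_cont: "isCont m x"
  using m_deriv DERIV_isCont by blast

lemma m'_pos: "m' x > 0"
  using V_pos[of x] V'_neg[of x] V'_pos[of x] D_pos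
  by (cases x x\<^sub>0 rule: linorder_cases) (auto simp: m'_def m_def divide_neg_neg divide_neg_pos)

text \<open>Away from \<open>x\<^sub>0\<close> the derivative is \<open>V' / (2 m)\<close>. Both \<open>V'\<close> and \<open>m\<close> vanish at \<open>x\<^sub>0\<close>; dividing them by
\<open>x - x\<^sub>0\<close> shows that the quotient tends to \<open>D / (2 sqrt (D / 2)) = sqrt (D / 2)\<close>.\<close>

lemma m'_cont: "isCont m' x"
proof (cases "x = x\<^sub>0")
  case True
  have "((\<lambda>x. (V' x / (x - x\<^sub>0)) / (2 * (m x / (x - x\<^sub>0)))) \<longlongrightarrow> D / (2 * sqrt (D / 2))) (at x\<^sub>0)"
    using D_pos by (intro tendsto_intros V'_quotient m_quotient) auto
  moreover have "D / (2 * sqrt (D / 2)) = sqrt (D / 2)"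
    using D_pos real_sqrt_mult_self[of "D / 2"] by (simp add: field_simps)
  ultimately have "((\<lambda>x. (V' x / (x - x\<^sub>0)) / (2 * (m x / (x - x\<^sub>0)))) \<longlongrightarrow> sqrt (D / 2)) (at x\<^sub>0)"
    by simp
  then have "(m' \<longlongrightarrow> sqrt (D / 2)) (at x\<^sub>0)"
  proof (rule Lim_transform_eventually)
    show "\<forall>\<^sub>F x in at x\<^sub>0. (V' x / (x - x\<^sub>0)) / (2 * (m x / (x - x\<^sub>0))) = m' x"
      unfolding eventually_at_filter
      by (intro always_eventually allI impI) (auto simp: m'_def)
  qed
  then show ?thesis using True by (simp add: isCont_def m'_def)
next
  case False
  have "m x \<noteq> 0" using m_square[of x] V_pos[OF False] by auto
  then have "isCont (\<lambda>x. V' x / (2 * m x)) x"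
    by (intro continuous_intros V'_cont m_cont) auto
  moreover have "\<forall>\<^sub>F t in nhds x. m' t = V' t / (2 * m t)"
    using t1_space_nhds[OF False] by (rule eventually_mono) (simp add: m'_def)
  ultimately show ?thesis using isCont_cong by fast
qed

end


section \<open>The potential of the height\<close>

text \<open>In terms of the logarithm \<open>x\<close> of the height, the potential \<open>W\<close> and all its companions are
polynomials in exponentials, defined and smooth on the whole line; the part \<open>x > 0\<close> is the
geometric one.\<close>

locale height_potential =
  fixes n :: real
  assumes n: "n > 1"
begin

definition W :: "real \<Rightarrow> real" where
  "W x = exp (- 2 * (n - 1) * x) - exp (- 2 * n * x)"

definition W' :: "real \<Rightarrow> real" where
  "W' x = 2 * exp (- 2 * n * x) * (n - (n - 1) * exp (2 * x))"

definition x\<^sub>0 :: real where "x\<^sub>0 = ln (n / (n - 1)) / 2"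

definition a :: real where "a = sqrt (W x\<^sub>0)"

lemma exp_x0: "exp (2 * x\<^sub>0) = n / (n - 1)"
  using n by (simp add: x\<^sub>0_def)

lemma x0_pos: "x\<^sub>0 > 0"
  using n by (simp add: x\<^sub>0_def)

lemma W_factor: "W x = exp (- 2 * n * x) * (exp (2 * x) - 1)"
  by (simp add: W_def algebra_simps flip: exp_add)

lemma W_x0: "W x\<^sub>0 = exp (- 2 * n * x\<^sub>0) / (n - 1)"
proof -
  have "exp (2 * x\<^sub>0) - 1 = 1 / (n - 1)" using n unfolding exp_x0 by (simp add: field_simps)
  then show ?thesis by (simp add: W_factor)
qed

lemma a_pos: "a > 0" and a_square: "a\<^sup>2 = W x\<^sub>0"
  using n by (simp_all add: a_def W_x0)

lemma W_deriv: "(W has_real_derivative W' x) (at x)"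
  unfolding W_def
  by (auto intro!: derivative_eq_intros simp: W'_def algebra_simps simp flip: exp_add)

lemma W'_sign:
  shows "x < x\<^sub>0 \<Longrightarrow> W' x > 0" and "x > x\<^sub>0 \<Longrightarrow> W' x < 0"
proof -
  have e: "n - (n - 1) * exp (2 * x) = (n - 1) * (exp (2 * x\<^sub>0) - exp (2 * x))"
    using n unfolding exp_x0 by (simp add: field_simps)
  show "x < x\<^sub>0 \<Longrightarrow> W' x > 0" "x > x\<^sub>0 \<Longrightarrow> W' x < 0"
    unfolding W'_def e using n by (auto intro!: mult_pos_pos mult_pos_neg)
qed

definition V :: "real \<Rightarrow> real" where "V x = a\<^sup>2 - W x"

definition V' :: "real \<Rightarrow> real" where "V' x = - W' x"

definition D :: real where "D = 4 * n * exp (- 2 * n * x\<^sub>0)"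

sublocale potential_well V V' x\<^sub>0 D
proof
  show "(V has_real_derivative V' x) (at x)" for x
    unfolding V_def V'_def by (auto intro!: derivative_eq_intros W_deriv)
  show "isCont V' x" for x
    unfolding V'_def W'_def by (intro continuous_intros)
  define E where "E = exp (2 * x\<^sub>0)"
  have E: "(n - 1) * E = n" using n unfolding E_def exp_x0 by simp
  have "(V' has_real_derivative 4 * exp (- 2 * n * x\<^sub>0) * (n * (n - (n - 1) * E) + (n - 1) * E)) (at x\<^sub>0)"
    unfolding V'_def W'_def E_def
    by (auto intro!: derivative_eq_intros simp: algebra_simps)
  then show "(V' has_real_derivative D) (at x\<^sub>0)"
    unfolding E by (simp add: D_def algebra_simps)
qed (use n W'_sign in \<open>auto simp: a_square V_def V'_def D_def\<close>)

lemma W_tendsto_0: "(W \<longlongrightarrow> 0) at_top"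
proof -
  have "((\<lambda>x. exp (- k * x)) \<longlongrightarrow> 0) at_top" if "k > 0" for k :: real
    by (rule filterlim_compose[OF exp_at_bot])
       (use that in \<open>intro filterlim_tendsto_neg_mult_at_bot[OF tendsto_const] filterlim_ident; simp\<close>)
  from tendsto_diff[OF this[of "2 * (n - 1)"] this[of "2 * n"]] n
  show ?thesis by (simp add: W_def[abs_def] algebra_simps)
qed

lemma m_tendsto_a: "(m \<longlongrightarrow> a) at_top"
proof -
  have "((\<lambda>x. sqrt (a\<^sup>2 - W x)) \<longlongrightarrow> sqrt (a\<^sup>2 - 0)) at_top"
    by (intro tendsto_intros W_tendsto_0)
  then have "((\<lambda>x. sqrt (a\<^sup>2 - W x)) \<longlongrightarrow> a) at_top"
    using a_pos by simp
  then show ?thesis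
  proof (rule Lim_transform_eventually)
    show "\<forall>\<^sub>F x in at_top. sqrt (a\<^sup>2 - W x) = m x"
      using eventually_ge_at_top[of x\<^sub>0] by eventually_elim (simp add: m_def V_def)
  qed
qed

lemma m_0: "m 0 = - a"
  using x0_pos a_pos by (simp add: m_def V_def W_def)

lemma m_less_a: "m x < a"
proof -
  have "strict_mono m" using inv_has_derivative(1)[OF m_deriv m'_pos] .
  then have "m x < m (x + 1)" by (simp add: strict_mono_less)
  also have "m (x + 1) \<le> a"
  proof (rule tendsto_lowerbound[OF m_tendsto_a])
    show "\<forall>\<^sub>F t in at_top. m (x + 1) \<le> m t"
      using eventually_ge_at_top[of "x + 1"] 
      by eventually_elim (use \<open>strict_mono m\<close> in \<open>simp add: strict_mono_less_eq\<close>)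
  qed simp
  finally show ?thesis .
qed

lemma m_mono: "strict_mono m"
  by (rule inv_has_derivative(1)[OF m_deriv m'_pos])

text \<open>The logarithmic height as a function of the coordinate \<open>m\<close>. The interval \<open>(-a, a)\<close> is the
image under \<open>m\<close> of the positive half-line.\<close>

definition \<xi> :: "real \<Rightarrow> real" where "\<xi> = inv m"

lemma \<xi>_m: "\<xi> (m x) = x"
  using m_mono by (simp add: \<xi>_def strict_mono_imp_inj_on)

lemma m_\<xi>:
  assumes "\<bar>w\<bar> < a"
  shows "m (\<xi> w) = w" and "\<xi> w > 0"
proof -
  have "\<forall>\<^sub>F x in at_top. w < m x"
    using assms by (intro order_tendstoD(1)[OF m_tendsto_a]) auto
  then have "\<forall>\<^sub>F x in at_top. w < m x \<and> 0 \<le> x"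
    by (intro eventually_conj eventually_ge_at_top)
  then obtain b where b: "w < m b" "0 \<le> b" using eventually_happens'[OF trivial_limit_at_top_linorder] by blast
  have "\<exists>x\<ge>0. x \<le> b \<and> m x = w"
    using b assms m_0 by (intro IVT') (auto intro!: continuous_at_imp_continuous_on m_cont)
  then obtain x where x: "x \<ge> 0" "m x = w" by blast
  moreover have "x \<noteq> 0" using x assms m_0 by auto
  ultimately show "m (\<xi> w) = w" "\<xi> w > 0" using \<xi>_m[of x] by auto
qed

definition \<xi>' :: "real \<Rightarrow> real" where "\<xi>' w = 1 / m' (\<xi> w)"

lemma \<xi>'_pos: "\<xi>' w > 0"
  by (simp add: \<xi>'_def m'_pos)

lemma \<xi>_deriv: "\<bar>w\<bar> < a \<Longrightarrow> (\<xi> has_real_derivative \<xi>' w) (at w)"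
  using inv_has_derivative(2)[OF m_deriv m'_pos, of "\<xi> w"]
  by (simp add: m_\<xi> \<xi>'_def flip: \<xi>_def)

lemma \<xi>_cont: "\<bar>w\<bar> < a \<Longrightarrow> isCont \<xi> w"
  using \<xi>_deriv DERIV_isCont by blast

lemma \<xi>'_cont: "\<bar>w\<bar> < a \<Longrightarrow> isCont \<xi>' w"
  unfolding \<xi>'_def[abs_def]
  by (intro continuous_intros isCont_o2[OF \<xi>_cont m'_cont]) (auto simp: less_imp_neq[OF m'_pos, symmetric])

lemma \<xi>_0: "\<xi> 0 = x\<^sub>0"
  using \<xi>_m[of x\<^sub>0] by (simp add: m_def V_x0)

lemma W_\<xi>: "\<bar>w\<bar> < a \<Longrightarrow> W (\<xi> w) = a\<^sup>2 - w\<^sup>2"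
  using m_square[of "\<xi> w"] by (simp add: m_\<xi> V_def)

text \<open>The derivative of \<open>W (\<xi> w) = a\<^sup>2 - w\<^sup>2\<close>, in a form that remains meaningful at \<open>w = 0\<close>.\<close>

lemma W'_\<xi>: "\<bar>w\<bar> < a \<Longrightarrow> W' (\<xi> w) * \<xi>' w = - 2 * w"
proof -
  assume w: "\<bar>w\<bar> < a"
  have "((\<lambda>x. (m x)\<^sup>2) has_real_derivative 2 * m (\<xi> w) * m' (\<xi> w)) (at (\<xi> w))"
    by (auto intro!: derivative_eq_intros m_deriv)
  moreover have "(\<lambda>x. (m x)\<^sup>2) = V" by (simp add: m_square)
  ultimately have "2 * m (\<xi> w) * m' (\<xi> w) = - W' (\<xi> w)"
    using V_deriv DERIV_unique V'_def by metis
  then show ?thesis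
    using w m'_pos[of "\<xi> w"] by (simp add: m_\<xi> \<xi>'_def field_simps)
qed


section \<open>The density of the rotation angle\<close>

text \<open>As \<open>dz / (z\<^sup>2 - 1)\<close> in the coordinate \<open>w\<close>: with \<open>z = e\<^sup>x\<close> and \<open>x = \<xi> w\<close> this form is \<open>Q w dw\<close>. Since
\<open>d\<theta> = c z\<^sup>n ds / (z\<^sup>2 - 1)\<close> and \<open>dz = z\<^sup>n v ds\<close>, the polar angle changes by \<open>(c / v) Q w dw\<close>.\<close>

definition Q :: "real \<Rightarrow> real" where
  "Q w = \<xi>' w * exp (\<xi> w) / (exp (2 * \<xi> w) - 1)"

lemma Q_cont: "\<bar>w\<bar> < a \<Longrightarrow> isCont Q w"
  unfolding Q_def[abs_def] using m_\<xi>(2)[of w]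
  by (intro continuous_intros \<xi>_cont \<xi>'_cont) auto

text \<open>This number carries the upper bound \<open>sqrt 2\<close> for \<open>2 q\<close>: it combines the curvature of \<open>W\<close> at its
maximum, which determines the frequency of small oscillations, with the angular speed on the circle.\<close>

lemma a_Q_0: "a * Q 0 = 1 / sqrt 2"
proof -
  define E where "E = exp (- 2 * n * x\<^sub>0)"
  have E: "E > 0" by (simp add: E_def)
  have x: "exp x\<^sub>0 = sqrt (n / (n - 1))"
    using exp_x0 by (metis exp_ge_zero exp_double real_sqrt_unique)
  have "exp (2 * x\<^sub>0) - 1 = 1 / (n - 1)" using n unfolding exp_x0 by (simp add: field_simps)
  moreover have "m' x\<^sub>0 = sqrt (D / 2)" by (simp add: m'_def)
  then have "m' x\<^sub>0 = sqrt (2 * n * E)" by (rule trans) (simp add: D_def E_def)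
  ultimately have "a * Q 0 = sqrt (E / (n - 1)) * (1 / sqrt (2 * n * E)) * sqrt (n / (n - 1)) * (n - 1)"
    by (simp add: Q_def \<xi>_0 \<xi>'_def a_def W_x0 x E_def mult.assoc)
  also have "\<dots> = 1 / sqrt 2"
  proof -
    define k where "k = sqrt (n - 1)"
    have k: "n - 1 = k * k" "k > 0" using n by (simp_all add: k_def)
    have "sqrt (n - 1) = k" by (simp add: k_def)
    then show ?thesis
      unfolding real_sqrt_mult real_sqrt_divide k(1) using n E k(2) by simp
  qed
  finally show ?thesis .
qed

text \<open>The function \<open>(a\<^sup>2 - w\<^sup>2) Q w\<close> in terms of \<open>x = \<xi> w\<close>. The derivative of the coordinate change has
been eliminated from it, so its limits at \<open>x = 0\<close> and at infinity can be read off.\<close>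

definition h :: "real \<Rightarrow> real" where
  "h x = exp x * m x / ((n - 1) * exp (2 * x) - n)"

lemma Q_h:
  assumes "\<bar>w\<bar> < a" "w \<noteq> 0"
  shows "Q w * (a\<^sup>2 - w\<^sup>2) = h (\<xi> w)"
proof -
  define x where "x = \<xi> w"
  have x: "x > 0" "m x = w" using m_\<xi> assms by (auto simp: x_def)
  have e: "exp (2 * x) - 1 \<noteq> 0" "exp (- 2 * n * x) \<noteq> 0" using x by auto
  have W': "W' x * \<xi>' w = - 2 * w" using W'_\<xi> assms by (simp add: x_def)
  then have "W' x \<noteq> 0" using assms by auto
  then have d: "(n - 1) * exp (2 * x) - n \<noteq> 0" by (auto simp: W'_def)
  have "exp (- 2 * n * x) * (\<xi>' w * ((n - 1) * exp (2 * x) - n)) = w"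
    using W' unfolding W'_def by (simp add: algebra_simps)
  then have "exp (- 2 * n * x) * \<xi>' w = w / ((n - 1) * exp (2 * x) - n)"
    using d by (simp add: field_simps)
  moreover have "a\<^sup>2 - w\<^sup>2 = exp (- 2 * n * x) * (exp (2 * x) - 1)"
    using W_\<xi>[OF assms(1)] by (simp add: W_factor flip: x_def)
  then have "Q w * (a\<^sup>2 - w\<^sup>2) = exp x * (exp (- 2 * n * x) * \<xi>' w)"
    unfolding Q_def x_def[symmetric] using e(1) by (simp add: divide_simps)
  ultimately show ?thesis by (simp add: h_def x flip: x_def)
qed

lemma h_tendsto_at_0: "(h \<longlongrightarrow> a) (at_right 0)"
proof -
  have "isCont h 0" unfolding h_def[abs_def] using n by (intro continuous_intros m_cont) auto
  then have "(h \<longlongrightarrow> a) (at 0)" by (simp add: isCont_def h_def m_0)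
  then show ?thesis by (rule filterlim_mono) (auto simp: at_le)
qed

lemma h_tendsto_at_top: "(h \<longlongrightarrow> 0) at_top"
proof -
  have "((\<lambda>x::real. exp (- x)) \<longlongrightarrow> 0) at_top"
    by (rule filterlim_compose[OF exp_at_bot filterlim_uminus_at_bot_at_top])
  then have "((\<lambda>x. exp (- x) * m x / ((n - 1) - n * (exp (- x) * exp (- x)))) \<longlongrightarrow>
      0 * a / ((n - 1) - n * (0 * 0))) at_top"
    using n by (intro tendsto_intros m_tendsto_a) auto
  moreover have "h = (\<lambda>x. exp (- x) * m x / ((n - 1) - n * (exp (- x) * exp (- x))))"
  proof
    fix x
    have "exp (- x) * m x / ((n - 1) - n * (exp (- x) * exp (- x)))
       = (exp (2 * x) * (exp (- x) * m x)) / (exp (2 * x) * ((n - 1) - n * (exp (- x) * exp (- x))))"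
      by simp
    also have "exp (2 * x) * (exp (- x) * m x) = exp x * m x"
      by (simp flip: exp_add mult.assoc)
    also have "exp (2 * x) * ((n - 1) - n * (exp (- x) * exp (- x))) = (n - 1) * exp (2 * x) - n"
      by (simp add: algebra_simps flip: exp_add)
    finally show "h x = exp (- x) * m x / ((n - 1) - n * (exp (- x) * exp (- x)))"
      by (simp add: h_def)
  qed
  ultimately show ?thesis by simp
qed

text \<open>Near the ends of \<open>(-a, a)\<close> one of \<open>\<xi> w\<close>, \<open>\<xi> (- w)\<close> is close to 0 and the other one is large, so
\<open>(a\<^sup>2 - w\<^sup>2) (Q w + Q (- w))\<close> is close to \<open>a + 0\<close>. On the remaining compact interval \<open>Q\<close> is bounded.\<close>

lemma Q_even_bound:
  assumes b: "b > 1 / 2"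
  shows "\<exists>M\<ge>0. \<forall>w. \<bar>w\<bar> < a \<longrightarrow> Q w + Q (- w) \<le> 2 * b * a / (a\<^sup>2 - w\<^sup>2) + M"
proof -
  define e where "e = (b - 1 / 2) * a"
  have e: "e > 0" using b a_pos by (simp add: e_def)
  have "\<forall>\<^sub>F x in at_right 0. h x < a + e"
    using e by (intro order_tendstoD(2)[OF h_tendsto_at_0]) auto
  then obtain l where l: "l > 0" "\<And>x. 0 < x \<Longrightarrow> x < l \<Longrightarrow> h x < a + e"
    by (auto simp: eventually_at_right_field)
  have "\<forall>\<^sub>F x in at_top. h x < e"
    using e by (intro order_tendstoD(2)[OF h_tendsto_at_top]) auto
  then obtain u where u: "\<And>x. x \<ge> u \<Longrightarrow> h x < e"
    by (auto simp: eventually_at_top_linorder)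
  \<comment> \<open>Beyond \<open>w1\<close> both limits of \<open>h\<close> are effective: at \<open>\<xi> w > u\<close> and at \<open>\<xi> (- w) < l\<close>.\<close>
  define w1 where "w1 = Max {0, - m l, m u}"
  have w1: "0 \<le> w1" "- m l \<le> w1" "m u \<le> w1" "w1 < a"
    using m_less_a[of u] a_pos strict_monoD[OF m_mono l(1)] by (auto simp: w1_def m_0)
  have outer: "Q w + Q (- w) \<le> 2 * b * a / (a\<^sup>2 - w\<^sup>2)" if w: "w1 < w" "w < a" for w
  proof -
    have "m (\<xi> w) > m u" using w w1 by (simp add: m_\<xi>)
    then have "h (\<xi> w) < e" using u m_mono by (simp add: strict_mono_less)
    moreover have "m (\<xi> (- w)) < m l" using w w1 by (simp add: m_\<xi>)
    then have "h (\<xi> (- w)) < a + e" using l m_mono w w1 m_\<xi>(2)[of "- w"] by (simp add: strict_mono_less)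
    ultimately have "(Q w + Q (- w)) * (a\<^sup>2 - w\<^sup>2) \<le> 2 * b * a"
      using Q_h[of w] Q_h[of "- w"] w w1 by (simp add: e_def algebra_simps)
    moreover have "a\<^sup>2 - w\<^sup>2 > 0" using w w1 by (simp add: power_strict_mono)
    ultimately show ?thesis by (simp add: field_simps)
  qed
  have "continuous_on {- w1..w1} (\<lambda>w. Q w + Q (- w))"
    using w1(4) by (intro continuous_at_imp_continuous_on ballI continuous_intros Q_cont
      isCont_o2[where g = Q] ) auto
  then have "bounded ((\<lambda>w. Q w + Q (- w)) ` {- w1..w1})"
    by (intro compact_imp_bounded compact_continuous_image) auto
  then obtain M where M: "M > 0" "\<forall>w\<in>{- w1..w1}. \<bar>Q w + Q (- w)\<bar> \<le> M"
    by (auto simp: bounded_pos)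
  show ?thesis
  proof (intro exI[of _ M] conjI allI impI)
    fix w assume w: "\<bar>w\<bar> < a"
    have p: "2 * b * a / (a\<^sup>2 - w\<^sup>2) \<ge> 0"
      using w b a_pos abs_le_square_iff[of w a] by (intro divide_nonneg_nonneg) auto
    consider "\<bar>w\<bar> \<le> w1" | "w1 < w" | "w1 < - w" by linarith
    then show "Q w + Q (- w) \<le> 2 * b * a / (a\<^sup>2 - w\<^sup>2) + M"
    proof cases
      case 1 then show ?thesis using bspec[OF M(2), of w] p by (auto simp: abs_le_iff)
    next
      case 2 then show ?thesis using outer[of w] w M by linarith
    next
      case 3
      then have "Q (- w) + Q w \<le> 2 * b * a / (a\<^sup>2 - w\<^sup>2)" using outer[of "- w"] w by auto
      then show ?thesis using M by linarith
    qed
  qed (use M in simp)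
qed

end


section \<open>Orbits and their rotation angle\<close>

text \<open>With \<open>k = c / a\<close> the antiderivative is \<open>arctan (k tan \<phi>) / c\<close>. It is written as
\<open>\<phi> - arctan ((1 - k) sin \<phi> cos \<phi> / (cos\<^sup>2 \<phi> + k sin\<^sup>2 \<phi>))\<close>, divided by \<open>c\<close>, which is the same up to the jumps of
the former at the poles of the tangent, and which is differentiable everywhere.\<close>

lemma integral_kernel:
  fixes a \<rho> :: real
  assumes "0 \<le> \<rho>" "\<rho> < a"
  shows "((\<lambda>\<phi>. a / (a\<^sup>2 - (\<rho> * sin \<phi>)\<^sup>2)) has_integral 2 * pi / sqrt (a\<^sup>2 - \<rho>\<^sup>2)) {0..2 * pi}"
proof -
  define c where "c = sqrt (a\<^sup>2 - \<rho>\<^sup>2)"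
  have c: "c > 0" "c\<^sup>2 = a\<^sup>2 - \<rho>\<^sup>2"
    using assms power_strict_mono[of \<rho> a 2] by (simp_all add: c_def)
  define k where "k = c / a"
  have k: "k > 0" using c assms by (simp add: k_def)
  define F where "F \<phi> = (\<phi> - arctan ((1 - k) * sin \<phi> * cos \<phi> / ((cos \<phi>)\<^sup>2 + k * (sin \<phi>)\<^sup>2))) / c"
    for \<phi> :: real
  have F: "(F has_real_derivative a / (a\<^sup>2 - (\<rho> * sin \<phi>)\<^sup>2)) (at \<phi>)" for \<phi>
  proof -
    define S C where "S = sin \<phi>" and "C = cos \<phi>"
    have SC: "S\<^sup>2 = 1 - C\<^sup>2" by (simp add: S_def C_def sin_squared_eq)
    define Dn where "Dn = C\<^sup>2 + k * S\<^sup>2"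
    define E where "E = C\<^sup>2 + k\<^sup>2 * S\<^sup>2"
    have "C \<noteq> 0 \<or> S \<noteq> 0" using SC by auto
    then have pos: "Dn > 0" "E > 0" unfolding Dn_def E_def
      using k by (auto simp: add_nonneg_pos add_pos_nonneg)
    define u where "u t = (1 - k) * sin t * cos t / ((cos t)\<^sup>2 + k * (sin t)\<^sup>2)" for t
    have num: "((\<lambda>t. (1 - k) * sin t * cos t) has_real_derivative (1 - k) * (C\<^sup>2 - S\<^sup>2)) (at \<phi>)"
      unfolding S_def C_def
      by (auto intro!: derivative_eq_intros simp: power2_eq_square algebra_simps)
    have den: "((\<lambda>t. (cos t)\<^sup>2 + k * (sin t)\<^sup>2) has_real_derivative - 2 * (1 - k) * S * C) (at \<phi>)"
      unfolding S_def C_def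
      by (auto intro!: derivative_eq_intros simp: power2_eq_square algebra_simps)
    have "(u has_real_derivative ((1 - k) * (C\<^sup>2 - S\<^sup>2) * Dn - ((1 - k) * S * C) * (- 2 * (1 - k) * S * C))
        / (Dn * Dn)) (at \<phi>)"
      using DERIV_divide[OF num den] pos(1) by (simp add: u_def[abs_def] Dn_def flip: S_def C_def)
    moreover have "((1 - k) * (C\<^sup>2 - S\<^sup>2) * Dn - ((1 - k) * S * C) * (- 2 * (1 - k) * S * C))
        / (Dn * Dn) = (1 - k) * ((C\<^sup>2 - S\<^sup>2) * Dn + 2 * (1 - k) * S\<^sup>2 * C\<^sup>2) / Dn\<^sup>2"
      by (simp add: power2_eq_square algebra_simps)
    ultimately have "(u has_real_derivative
        (1 - k) * ((C\<^sup>2 - S\<^sup>2) * Dn + 2 * (1 - k) * S\<^sup>2 * C\<^sup>2) / Dn\<^sup>2) (at \<phi>)" by simp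
    from DERIV_chain2[OF DERIV_arctan this]
    have "((\<lambda>t. arctan (u t)) has_real_derivative
        (1 - k) * ((C\<^sup>2 - S\<^sup>2) * Dn + 2 * (1 - k) * S\<^sup>2 * C\<^sup>2) / Dn\<^sup>2 / (1 + (u \<phi>)\<^sup>2)) (at \<phi>)"
      by (simp add: field_simps)
    moreover have "u \<phi> = (1 - k) * S * C / Dn" by (simp add: u_def Dn_def S_def C_def)
    ultimately have "(F has_real_derivative (1 - (1 - k) * ((C\<^sup>2 - S\<^sup>2) * Dn + 2 * (1 - k) * S\<^sup>2 * C\<^sup>2) / Dn\<^sup>2
        / (1 + ((1 - k) * S * C / Dn)\<^sup>2)) / c) (at \<phi>)"
      unfolding F_def u_def[symmetric]
      by (intro DERIV_cdivide DERIV_diff DERIV_ident) simp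
    moreover have "1 + ((1 - k) * S * C / Dn)\<^sup>2 = E / Dn\<^sup>2"
    proof -
      have "Dn\<^sup>2 + ((1 - k) * S * C)\<^sup>2 = E" unfolding Dn_def E_def using SC by algebra
      then show ?thesis using pos by (simp add: field_simps)
    qed
    moreover have "(C\<^sup>2 - S\<^sup>2) * Dn + 2 * (1 - k) * S\<^sup>2 * C\<^sup>2 = C\<^sup>2 - k * S\<^sup>2"
      unfolding Dn_def using SC by algebra
    moreover have "1 - (1 - k) * (C\<^sup>2 - k * S\<^sup>2) / Dn\<^sup>2 / (E / Dn\<^sup>2) = k / E"
    proof -
      have "E - (1 - k) * (C\<^sup>2 - k * S\<^sup>2) = k" unfolding E_def using SC by algebra
      then have *: "(1 - k) * (C\<^sup>2 - k * S\<^sup>2) = E - k" by simp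
      show ?thesis unfolding * using pos by (simp add: divide_simps)
    qed
    moreover have "k / E / c = a / (a\<^sup>2 - (\<rho> * sin \<phi>)\<^sup>2)"
    proof -
      have "a\<^sup>2 * E = a\<^sup>2 * C\<^sup>2 + c\<^sup>2 * S\<^sup>2"
        using assms by (simp add: E_def k_def power_divide field_simps)
      also have "\<dots> = a\<^sup>2 - (\<rho> * S)\<^sup>2"
        unfolding c using SC by algebra
      finally have "a\<^sup>2 - (\<rho> * S)\<^sup>2 = a\<^sup>2 * E" by simp
      then show ?thesis using pos assms c by (simp add: k_def S_def power2_eq_square)
    qed
    ultimately show ?thesis by metis
  qed
  have "((\<lambda>\<phi>. a / (a\<^sup>2 - (\<rho> * sin \<phi>)\<^sup>2)) has_integral F (2 * pi) - F 0) {0..2 * pi}"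
    by (intro has_integral_antiderivative F) simp
  then show ?thesis by (simp add: F_def c_def)
qed

context height_potential
begin

lemma sin_bound: "\<bar>\<rho>\<bar> < a \<Longrightarrow> \<bar>\<rho> * sin \<phi>\<bar> < a"
  using mult_left_le[of "\<bar>sin \<phi>\<bar>" "\<bar>\<rho>\<bar>"] by (simp add: abs_mult)

lemma Q_sin_cont: "\<bar>\<rho>\<bar> < a \<Longrightarrow> isCont (\<lambda>\<phi>. Q (\<rho> * sin \<phi>)) \<phi>"
  by (rule isCont_o2[where g = Q]) (auto intro!: continuous_intros Q_cont sin_bound)

text \<open>The growth of the polar angle in one period; the square root is the parameter \<open>c\<close> of the curve.\<close>

definition \<Lambda> :: "real \<Rightarrow> real" where
  "\<Lambda> \<rho> = sqrt (a\<^sup>2 - \<rho>\<^sup>2) * integral {0..2 * pi} (\<lambda>\<phi>. Q (\<rho> * sin \<phi>))"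

text \<open>The circle \<open>w = \<rho> sin \<phi>\<close>, \<open>v = \<rho> cos \<phi>\<close> is traversed with a speed dictated by
\<open>x' = e\<^sup>(\<^sup>n\<^sup>-\<^sup>1\<^sup>)\<^sup>x v\<close>: for \<open>x = \<xi> w\<close> this reads \<open>\<xi>' w \<phi>' = e\<^sup>(\<^sup>n\<^sup>-\<^sup>1\<^sup>)\<^sup>x\<close>, so that \<open>ds / d\<phi>\<close> is a positive periodic function
of \<open>\<phi>\<close>. The arc length \<open>\<sigma>\<close> is an antiderivative of it and \<open>\<phi> = \<tau> s\<close> is the inverse function of \<open>\<sigma>\<close>. The
equation for \<open>v\<close> then follows by differentiating \<open>W (\<xi> w) = a\<^sup>2 - w\<^sup>2\<close>.\<close>

lemma orbit:
  assumes \<rho>: "0 < \<rho>" "\<rho> < a"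
  obtains x v \<theta> :: "real \<Rightarrow> real" and L where
    "\<And>s. x s > 0"
    "\<And>s. (x has_real_derivative exp ((n - 1) * x s) * v s) (at s)"
    "\<And>s. (v has_real_derivative exp (- (n + 1) * x s) * (n - (n - 1) * exp (2 * x s))) (at s)"
    "\<And>s. (\<theta> has_real_derivative sqrt (a\<^sup>2 - \<rho>\<^sup>2) * exp (n * x s) / (exp (2 * x s) - 1)) (at s)"
    "\<And>s. (v s)\<^sup>2 = W (x s) - (a\<^sup>2 - \<rho>\<^sup>2)"
    "L > 0" "\<And>s. x (s + L) = x s" "\<And>s. \<theta> (s + L) = \<theta> s + \<Lambda> \<rho>"
    "\<exists>s t. x s \<noteq> x t"
proof -
  define c where "c = sqrt (a\<^sup>2 - \<rho>\<^sup>2)"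
  define w where "w \<phi> = \<rho> * sin \<phi>" for \<phi>
  have w: "\<bar>w \<phi>\<bar> < a" for \<phi> using sin_bound[of \<rho>] \<rho> by (simp add: w_def)
  have w_cont: "isCont w \<phi>" for \<phi> unfolding w_def[abs_def] by (intro continuous_intros)
  have w_per: "w (\<phi> + 2 * pi) = w \<phi>" for \<phi> by (simp add: w_def)
  define \<sigma>' where "\<sigma>' \<phi> = \<xi>' (w \<phi>) * exp (- (n - 1) * \<xi> (w \<phi>))" for \<phi>
  have \<sigma>'_pos: "\<sigma>' \<phi> > 0" for \<phi> by (simp add: \<sigma>'_def \<xi>'_pos)
  have \<sigma>'_cont: "isCont \<sigma>' \<phi>" for \<phi>
    unfolding \<sigma>'_def[abs_def]
    by (intro continuous_intros isCont_o2[OF w_cont \<xi>_cont] isCont_o2[OF w_cont \<xi>'_cont] w)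
  obtain \<sigma> where \<sigma>: "\<And>\<phi>. (\<sigma> has_real_derivative \<sigma>' \<phi>) (at \<phi>)"
    and \<sigma>_per: "\<And>\<phi>. \<sigma> (\<phi> + 2 * pi) = \<sigma> \<phi> + integral {0..2 * pi} \<sigma>'"
    by (rule periodic_antiderivative[of \<sigma>' "2 * pi"]) (auto simp: \<sigma>'_cont \<sigma>'_def w_per)
  define L where "L = integral {0..2 * pi} \<sigma>'"
  note \<sigma>_inv = inv_has_derivative[OF \<sigma> \<sigma>'_pos]
  have "\<sigma> 0 < \<sigma> (0 + 2 * pi)" using \<sigma>_inv(1) by (simp add: strict_mono_less)
  then have L: "L > 0" unfolding \<sigma>_per by (simp add: L_def)
  define \<tau> where "\<tau> = inv \<sigma>"
  have \<tau>\<sigma>: "\<tau> (\<sigma> \<phi>) = \<phi>" for \<phi>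
    using \<sigma>_inv(1) by (simp add: \<tau>_def strict_mono_imp_inj_on)
  have "surj \<sigma>"
    using \<sigma>_per L unfolding L_def
    by (intro quasi_periodic_surj[of \<sigma> "2 * pi"]) (auto intro: DERIV_isCont[OF \<sigma>])
  then have \<sigma>\<tau>: "\<sigma> (\<tau> s) = s" for s by (simp add: \<tau>_def surj_f_inv_f)
  have \<tau>: "(\<tau> has_real_derivative 1 / \<sigma>' (\<tau> s)) (at s)" for s
    using \<sigma>_inv(2)[of "\<tau> s"] by (simp add: \<sigma>\<tau> flip: \<tau>_def)
  have \<tau>_per: "\<tau> (s + L) = \<tau> s + 2 * pi" for s
    using \<tau>\<sigma>[of "\<tau> s + 2 * pi"] by (simp add: \<sigma>_per \<sigma>\<tau> L_def)
  obtain \<Theta> where \<Theta>: "\<And>\<phi>. (\<Theta> has_real_derivative c * Q (w \<phi>)) (at \<phi>)"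
    and \<Theta>_per: "\<And>\<phi>. \<Theta> (\<phi> + 2 * pi) = \<Theta> \<phi> + integral {0..2 * pi} (\<lambda>\<phi>. c * Q (w \<phi>))"
    by (rule periodic_antiderivative[of "\<lambda>\<phi>. c * Q (w \<phi>)" "2 * pi"])
       (auto intro!: continuous_intros isCont_o2[OF w_cont Q_cont] simp: w w_per)
  define x where "x s = \<xi> (w (\<tau> s))" for s
  define v where "v s = \<rho> * cos (\<tau> s)" for s
  define \<theta> where "\<theta> s = \<Theta> (\<tau> s)" for s
  have inv_\<sigma>': "1 / \<sigma>' (\<tau> s) = exp ((n - 1) * x s) / \<xi>' (w (\<tau> s))" for s
    proof -
    have "exp (- (n - 1) * x s) = 1 / exp ((n - 1) * x s)" unfolding minus_mult_left[symmetric] by (simp only: exp_minus inverse_eq_divide)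
    then show ?thesis by (simp add: \<sigma>'_def flip: x_def)
  qed
  show thesis
  proof (rule that[of x v \<theta> L])
    fix s
    define u where "u = w (\<tau> s)"
    have u: "\<bar>u\<bar> < a" "\<xi>' u > 0" by (simp_all add: u_def w \<xi>'_pos)
    have x: "x s = \<xi> u" by (simp add: x_def u_def)
    show "x s > 0" using m_\<xi>(2)[OF u(1)] x by simp
    show "(x has_real_derivative exp ((n - 1) * x s) * v s) (at s)"
    proof -
      have "(w has_real_derivative v s) (at (\<tau> s))"
        unfolding w_def[abs_def] v_def by (auto intro!: derivative_eq_intros)
      then have "((\<lambda>t. \<xi> (w (\<tau> t))) has_real_derivative \<xi>' u * (v s * (1 / \<sigma>' (\<tau> s)))) (at s)"
        unfolding u_def
        by (intro DERIV_chain2[where f = \<xi> and g = "\<lambda>t. w (\<tau> t)"] \<xi>_deriv w DERIV_chain2[OF _ \<tau>])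
      moreover have "\<xi>' u * (v s * (1 / \<sigma>' (\<tau> s))) = exp ((n - 1) * x s) * v s"
        unfolding inv_\<sigma>' u_def[symmetric] using u(2) by simp
      ultimately show ?thesis by (simp add: x_def[abs_def])
    qed
    show "(v has_real_derivative exp (- (n + 1) * x s) * (n - (n - 1) * exp (2 * x s))) (at s)"
    proof -
      have "(v has_real_derivative \<rho> * (- sin (\<tau> s) * (1 / \<sigma>' (\<tau> s)))) (at s)"
        unfolding v_def[abs_def] by (intro DERIV_cmult DERIV_chain2[OF DERIV_cos \<tau>])
      moreover have "\<rho> * (- sin (\<tau> s) * (1 / \<sigma>' (\<tau> s))) = - u * (exp ((n - 1) * x s) / \<xi>' u)"
        unfolding inv_\<sigma>' u_def[symmetric] by (simp add: u_def w_def)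
      moreover have "- u * (exp ((n - 1) * x s) / \<xi>' u) = W' (x s) / 2 * exp ((n - 1) * x s)"
      proof -
        have "W' (x s) = - 2 * u / \<xi>' u" using W'_\<xi>[OF u(1)] u(2) x by (simp add: field_simps)
        then show ?thesis by simp
      qed
      moreover have "W' (x s) / 2 * exp ((n - 1) * x s)
          = (exp (- 2 * n * x s) * exp ((n - 1) * x s)) * (n - (n - 1) * exp (2 * x s))"
        by (simp add: W'_def)
      moreover have "exp (- 2 * n * x s) * exp ((n - 1) * x s) = exp (- (n + 1) * x s)"
        by (simp add: algebra_simps flip: exp_add)
      ultimately show ?thesis by metis
    qed
    show "(\<theta> has_real_derivative sqrt (a\<^sup>2 - \<rho>\<^sup>2) * exp (n * x s) / (exp (2 * x s) - 1)) (at s)"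
    proof -
      have "(\<theta> has_real_derivative c * Q u * (1 / \<sigma>' (\<tau> s))) (at s)"
        unfolding \<theta>_def[abs_def] u_def by (intro DERIV_chain2[OF \<Theta> \<tau>])
      moreover have "c * Q u * (1 / \<sigma>' (\<tau> s))
          = c * (exp (x s) * exp ((n - 1) * x s)) / (exp (2 * x s) - 1)"
        unfolding inv_\<sigma>' u_def[symmetric] using u(2) by (simp add: Q_def x)
      moreover have "exp (x s) * exp ((n - 1) * x s) = exp (n * x s)"
        by (simp add: algebra_simps flip: exp_add)
      ultimately show ?thesis by (simp add: c_def)
    qed
    show "(v s)\<^sup>2 = W (x s) - (a\<^sup>2 - \<rho>\<^sup>2)"
    proof -
      have "(v s)\<^sup>2 = \<rho>\<^sup>2 - u\<^sup>2"
        by (simp add: v_def u_def w_def power_mult_distrib cos_squared_eq algebra_simps)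
      then show ?thesis using W_\<xi>[OF u(1)] x by simp
    qed
    show "x (s + L) = x s" by (simp add: x_def \<tau>_per w_per)
    show "\<theta> (s + L) = \<theta> s + \<Lambda> \<rho>"
      by (simp add: \<theta>_def \<tau>_per \<Theta>_per \<Lambda>_def c_def w_def)
  next
    have "w 0 \<noteq> w (pi / 2)" using \<rho> by (simp add: w_def)
    then have "\<xi> (w 0) \<noteq> \<xi> (w (pi / 2))" using m_\<xi>(1)[OF w] by metis
    then have "x (\<sigma> 0) \<noteq> x (\<sigma> (pi / 2))" by (simp add: x_def \<tau>\<sigma>)
    then show "\<exists>s t. x s \<noteq> x t" by blast
  qed (rule L)
qed

lemma \<Lambda>_cont: "continuous_on {0..<a} \<Lambda>"
proof -
  have "isCont (\<lambda>z. Q (fst z * sin (snd z))) z" if "z \<in> {0..<a} \<times> cbox 0 (2 * pi)" for z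
  proof (rule isCont_o2[where g = Q])
    show "isCont (\<lambda>z. fst z * sin (snd z)) z" by (intro continuous_intros)
    show "isCont Q (fst z * sin (snd z))" using that by (intro Q_cont sin_bound) auto
  qed
  then have "continuous_on ({0..<a} \<times> cbox 0 (2 * pi)) (\<lambda>(\<rho>, \<phi>). Q (\<rho> * sin \<phi>))"
    unfolding case_prod_unfold by (intro continuous_at_imp_continuous_on ballI)
  then have "continuous_on {0..<a} (\<lambda>\<rho>. integral (cbox 0 (2 * pi)) (\<lambda>\<phi>. Q (\<rho> * sin \<phi>)))"
    by (rule integral_continuous_on_param)
  then show ?thesis
    unfolding \<Lambda>_def[abs_def] by (intro continuous_intros) simp_all
qed

lemma \<Lambda>_0: "\<Lambda> 0 = sqrt 2 * pi"
proof -
  have "\<Lambda> 0 = 2 * pi * (a * Q 0)" using a_pos by (simp add: \<Lambda>_def)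
  also have "\<dots> = (2 / sqrt 2) * pi" unfolding a_Q_0 by simp
  finally show ?thesis by (simp add: real_div_sqrt)
qed

text \<open>The bound on the even part of \<open>Q\<close>, integrated, gives \<open>\<Lambda> \<rho> \<le> 2 \<pi> b + \<pi> M c\<close> for a \<open>b\<close> strictly between
\<open>1 / 2\<close> and \<open>q\<close>. The second term becomes negligible as \<open>c = sqrt (a\<^sup>2 - \<rho>\<^sup>2)\<close> tends to 0.\<close>

lemma \<Lambda>_small:
  assumes q: "q > 1 / 2"
  obtains \<rho> where "0 < \<rho>" "\<rho> < a" "\<Lambda> \<rho> < 2 * pi * q"
proof -
  define b where "b = (q + 1 / 2) / 2"
  have b: "1 / 2 < b" "b < q" using q by (simp_all add: b_def)
  obtain M where M: "M \<ge> 0" "\<forall>w. \<bar>w\<bar> < a \<longrightarrow> Q w + Q (- w) \<le> 2 * b * a / (a\<^sup>2 - w\<^sup>2) + M"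
    using Q_even_bound[OF b(1)] by auto
  \<comment> \<open>Small enough for \<open>\<pi> M c < 2 \<pi> (q - b)\<close>.\<close>
  define c where "c = min (a / 2) ((q - b) / (M + 1))"
  have c: "0 < c" "c < a" "M * c < 2 * (q - b)"
  proof -
    show "0 < c" "c < a" using a_pos M(1) b by (auto simp: c_def min_less_iff_disj)
    have "M * c \<le> M * ((q - b) / (M + 1))" using M(1) by (intro mult_left_mono) (auto simp: c_def)
    also have "\<dots> \<le> q - b" using M(1) b by (simp add: field_simps)
    finally show "M * c < 2 * (q - b)" using b by simp
  qed
  define \<rho> where "\<rho> = sqrt (a\<^sup>2 - c\<^sup>2)"
  have "c\<^sup>2 < a\<^sup>2" using c by (intro power_strict_mono) auto
  then have \<rho>: "\<rho> > 0" "\<rho>\<^sup>2 = a\<^sup>2 - c\<^sup>2" by (simp_all add: \<rho>_def)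
  have "\<rho> < a" using \<rho> c a_pos by (intro power_less_imp_less_base[of \<rho> 2 a]) auto
  then have w: "\<bar>\<rho> * sin \<phi>\<bar> < a" for \<phi> using sin_bound \<rho> by simp
  have sq: "sqrt (a\<^sup>2 - \<rho>\<^sup>2) = c" using \<rho> c by simp
  obtain F where F: "\<And>\<phi>. (F has_real_derivative Q (\<rho> * sin \<phi>)) (at \<phi>)"
    and "\<And>\<phi>. F (\<phi> + 2 * pi) = F \<phi> + integral {0..2 * pi} (\<lambda>\<phi>. Q (\<rho> * sin \<phi>))"
    by (rule periodic_antiderivative[of "\<lambda>\<phi>. Q (\<rho> * sin \<phi>)" "2 * pi"])
      (use \<rho> \<open>\<rho> < a\<close> in \<open>auto intro: Q_sin_cont\<close>)
  define I where "I = F (2 * pi) - F 0"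
  have I: "((\<lambda>\<phi>. Q (\<rho> * sin \<phi>)) has_integral I) {0..2 * pi}"
    unfolding I_def by (intro has_integral_antiderivative F) simp
  \<comment> \<open>The reflection \<open>\<phi> \<mapsto> 2 \<pi> - \<phi>\<close> shows that \<open>Q (- \<rho> sin \<phi>)\<close> has the same integral \<open>I\<close>.\<close>
  have "((\<lambda>\<phi>. - F (2 * pi - \<phi>)) has_real_derivative Q (- (\<rho> * sin \<phi>))) (at \<phi>)" for \<phi>
  proof -
    have "((\<lambda>\<phi>. F (2 * pi - \<phi>)) has_real_derivative Q (\<rho> * sin (2 * pi - \<phi>)) * (- 1)) (at \<phi>)"
      by (rule DERIV_chain2[where f = F and g = "\<lambda>\<phi>. 2 * pi - \<phi>", OF F])
        (auto intro!: derivative_eq_intros)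
    from DERIV_minus[OF this] show ?thesis by (simp add: sin_diff)
  qed
  then have "((\<lambda>\<phi>. Q (- (\<rho> * sin \<phi>))) has_integral - F (2 * pi - 2 * pi) - - F (2 * pi - 0)) {0..2 * pi}"
    by (rule has_integral_antiderivative) simp
  then have "((\<lambda>\<phi>. Q (\<rho> * sin \<phi>) + Q (- (\<rho> * sin \<phi>))) has_integral I + I) {0..2 * pi}"
    by (intro has_integral_add I) (simp add: I_def)
  moreover have "((\<lambda>\<phi>. 2 * b * (a / (a\<^sup>2 - (\<rho> * sin \<phi>)\<^sup>2)) + M) has_integral
      2 * b * (2 * pi / c) + M * (2 * pi)) {0..2 * pi}"
    using integral_kernel[of \<rho> a] \<rho> \<open>\<rho> < a\<close> sq has_integral_const_real[of M 0 "2 * pi"]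
    by (intro has_integral_add has_integral_mult_right) (auto simp: mult.commute)
  ultimately have "I + I \<le> 2 * b * (2 * pi / c) + M * (2 * pi)"
    by (rule has_integral_le) (use M(2) w in simp)
  then have "c * (I + I) \<le> c * (2 * b * (2 * pi / c) + M * (2 * pi))"
    using c by (intro mult_left_mono) auto
  also have "\<dots> = 4 * pi * b + 2 * pi * (M * c)"
    using c by (simp add: field_simps)
  also have "\<dots> < 4 * pi * b + 2 * pi * (2 * (q - b))"
    using c by (intro add_strict_left_mono mult_strict_left_mono) auto
  finally have "c * I < 2 * pi * q" by (simp add: algebra_simps)
  moreover have "\<Lambda> \<rho> = c * I" using I by (simp add: \<Lambda>_def sq integral_unique)
  ultimately show thesis using that \<rho> \<open>\<rho> < a\<close> by simp
qed

lemma \<Lambda>_attains: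
  assumes "1 < 2 * q" "2 * q < sqrt 2"
  obtains \<rho> where "0 < \<rho>" "\<rho> < a" "\<Lambda> \<rho> = 2 * pi * q"
proof -
  obtain r where r: "0 < r" "r < a" "\<Lambda> r < 2 * pi * q"
    using \<Lambda>_small[of q] assms by auto
  have lt: "2 * pi * q < \<Lambda> 0" using assms(2) mult_strict_left_mono[of "2 * q" "sqrt 2" pi]
    by (simp add: \<Lambda>_0 mult_ac)
  have "\<exists>\<rho>\<ge>0. \<rho> \<le> r \<and> \<Lambda> \<rho> = 2 * pi * q"
    using r lt by (intro IVT2' continuous_on_subset[OF \<Lambda>_cont]) auto
  then obtain \<rho> where "\<rho> \<ge> 0" "\<rho> \<le> r" "\<Lambda> \<rho> = 2 * pi * q" by blast
  moreover have "\<rho> \<noteq> 0" using calculation lt by auto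
  ultimately show thesis using that[of \<rho>] r by simp
qed

end


section \<open>Curves in the hyperboloid\<close>

definition point :: "real \<Rightarrow> real \<Rightarrow> real \<Rightarrow> real^3" where
  "point a b c = a *\<^sub>R axis 1 1 + b *\<^sub>R axis 2 1 + c *\<^sub>R axis 3 1"

lemma point_nth [simp]:
  "point a b c $ 1 = a" "point a b c $ 2 = b" "point a b c $ 3 = c"
  by (simp_all add: point_def axis_def)

lemma point_vderiv:
  assumes "\<And>s. (f has_real_derivative f' s) (at s)" "\<And>s. (g has_real_derivative g' s) (at s)"
    "\<And>s. (h has_real_derivative h' s) (at s)"
  shows "((\<lambda>s. point (f s) (g s) (h s)) has_vector_derivative point (f' s) (g' s) (h' s)) (at s)"
    and "vderiv (\<lambda>s. point (f s) (g s) (h s)) = (\<lambda>s. point (f' s) (g' s) (h' s))"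
proof -
  show *: "((\<lambda>s. point (f s) (g s) (h s)) has_vector_derivative point (f' s) (g' s) (h' s)) (at s)" for s
    unfolding point_def
    by (auto intro!: derivative_eq_intros assms[unfolded has_real_derivative_iff_has_vector_derivative]
        simp: has_vector_derivative_scaleR assms)
  show "vderiv (\<lambda>s. point (f s) (g s) (h s)) = (\<lambda>s. point (f' s) (g' s) (h' s))"
    using * vector_derivative_at by blast
qed

text \<open>If \<open>\<A>\<close> is closed under differentiation, derivatives of every order have their coordinates in \<open>\<A>\<close>, so
smoothness follows without formulas for the higher derivatives.\<close>

lemma smooth_curve_point:
  assumes "\<And>f. f \<in> \<A> \<Longrightarrow> \<exists>f'\<in>\<A>. \<forall>s. (f has_real_derivative f' s) (at s)"
    and "f \<in> \<A>" "g \<in> \<A>" "h \<in> \<A>"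
  shows "smooth_curve (\<lambda>s. point (f s) (g s) (h s))"
proof -
  have "\<forall>f\<in>\<A>. \<exists>f'. f' \<in> \<A> \<and> (\<forall>s. (f has_real_derivative f' s) (at s))"
    using assms(1) by blast
  then obtain d where d: "\<And>f. f \<in> \<A> \<Longrightarrow> d f \<in> \<A>"
    "\<And>f s. f \<in> \<A> \<Longrightarrow> (f has_real_derivative d f s) (at s)"
    by (metis bchoice)
  have mem: "(d ^^ k) f \<in> \<A>" if "f \<in> \<A>" for f k
    using that by (induction k) (auto intro: d(1))
  have derivs: "(vderiv ^^ k) (\<lambda>s. point (f s) (g s) (h s)) =
    (\<lambda>s. point ((d ^^ k) f s) ((d ^^ k) g s) ((d ^^ k) h s))" for k
  proof (induction k)
    case (Suc k)
    then show ?case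
      using point_vderiv(2)[OF d(2) d(2) d(2), OF mem mem mem] assms(2-4) by simp
  qed simp
  show ?thesis
    unfolding smooth_curve_def derivs
  proof (intro allI)
    fix k s
    show "(\<lambda>s. point ((d ^^ k) f s) ((d ^^ k) g s) ((d ^^ k) h s)) differentiable at s"
      using point_vderiv(1)[OF d(2) d(2) d(2), OF mem mem mem, OF assms(2-4)]
      by (rule differentiableI_vector)
  qed
qed

text \<open>In cylindrical coordinates with \<open>r\<^sup>2 = z\<^sup>2 - 1\<close>, the fields \<open>e\<^sub>R = (z X, z Y, z\<^sup>2 - 1)\<close> and
\<open>e\<^sub>\<theta> = (- Y, X, 0)\<close> are tangent to the hyperboloid, orthogonal, and of length \<open>r\<close>. The assumptions on
\<open>X\<close>, \<open>Y\<close>, \<open>z\<close> say that \<open>T = A e\<^sub>R + B e\<^sub>\<theta>\<close>; then \<open>N = - B e\<^sub>R + A e\<^sub>\<theta>\<close>, and the assumptions on \<open>A\<close> and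
\<open>B\<close> say that \<open>T' = \<gamma> + \<kappa> N\<close>. All equations are polynomial, because the reciprocal \<open>\<zeta>\<close> of \<open>r\<^sup>2\<close> is treated
as a separate function.\<close>

lemma curve_from_frame_equations:
  fixes X Y z A B \<zeta> \<kappa> :: "real \<Rightarrow> real"
  defines "\<gamma> \<equiv> \<lambda>s. point (X s) (Y s) (z s)"
  assumes smooth: "smooth_curve \<gamma>"
    and X: "\<And>s. (X has_real_derivative A s * z s * X s - B s * Y s) (at s)"
    and Y: "\<And>s. (Y has_real_derivative A s * z s * Y s + B s * X s) (at s)"
    and z: "\<And>s. (z has_real_derivative A s * ((z s)\<^sup>2 - 1)) (at s)"
    and A: "\<And>s. (A has_real_derivative \<zeta> s * z s - \<kappa> s * B s - 2 * z s * (A s)\<^sup>2) (at s)"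
    and B: "\<And>s. (B has_real_derivative A s * (\<kappa> s - 2 * z s * B s)) (at s)"
    and z1: "\<And>s. z s > 1"
    and r: "\<And>s. (X s)\<^sup>2 + (Y s)\<^sup>2 = (z s)\<^sup>2 - 1"
    and \<zeta>: "\<And>s. \<zeta> s * ((z s)\<^sup>2 - 1) = 1"
    and AB: "\<And>s. (A s)\<^sup>2 + (B s)\<^sup>2 = \<zeta> s"
  shows "unit_speed_curve \<gamma>" and "geodesic_curvature \<gamma> s = \<kappa> s"
proof -
  have T: "vderiv \<gamma> = (\<lambda>s. point (A s * z s * X s - B s * Y s) (A s * z s * Y s + B s * X s)
      (A s * ((z s)\<^sup>2 - 1)))"
    unfolding \<gamma>_def by (rule point_vderiv(2)[OF X Y z])
  have \<gamma>s: "\<gamma> s = point (X s) (Y s) (z s)" for s by (simp add: \<gamma>_def)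
  have Ts: "vderiv \<gamma> s = point (A s * z s * X s - B s * Y s) (A s * z s * Y s + B s * X s)
      (A s * ((z s)\<^sup>2 - 1))" for s
    using T by metis
  have unit: "lorentz (vderiv \<gamma> s) (vderiv \<gamma> s) = 1" for s
  proof -
    have "lorentz (vderiv \<gamma> s) (vderiv \<gamma> s) = ((A s)\<^sup>2 * (z s)\<^sup>2 + (B s)\<^sup>2) * ((X s)\<^sup>2 + (Y s)\<^sup>2)
        - (A s)\<^sup>2 * ((z s)\<^sup>2 - 1)\<^sup>2"
      by (simp add: Ts lorentz_def power2_eq_square algebra_simps)
    also have "\<dots> = ((A s)\<^sup>2 + (B s)\<^sup>2) * ((z s)\<^sup>2 - 1)"
      unfolding r by (simp add: power2_eq_square algebra_simps)
    finally show ?thesis by (simp add: AB \<zeta>)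
  qed
  have hyp: "lorentz (\<gamma> s) (\<gamma> s) = - 1" for s
    using r[of s] by (simp add: \<gamma>s lorentz_def power2_eq_square)
  show us: "unit_speed_curve \<gamma>"
    unfolding unit_speed_curve_def hyperbolic_plane_def
    using smooth hyp unit less_trans[OF zero_less_one z1] by (simp add: \<gamma>s)
  define N where "N = point (- B s * z s * X s - A s * Y s) (- B s * z s * Y s + A s * X s)
      (- B s * ((z s)\<^sup>2 - 1))"
  have "is_unit_normal (\<gamma> s) (vderiv \<gamma> s) N"
  proof -
    have "lorentz N (\<gamma> s) = - B s * z s * ((X s)\<^sup>2 + (Y s)\<^sup>2 - ((z s)\<^sup>2 - 1))"
      by (simp add: N_def \<gamma>s lorentz_def power2_eq_square algebra_simps)
    then have "lorentz N (\<gamma> s) = 0" by (simp add: r)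
    moreover have "lorentz N N = ((B s)\<^sup>2 * (z s)\<^sup>2 + (A s)\<^sup>2) * ((X s)\<^sup>2 + (Y s)\<^sup>2)
        - (B s)\<^sup>2 * ((z s)\<^sup>2 - 1)\<^sup>2"
      by (simp add: N_def lorentz_def power2_eq_square algebra_simps)
    then have "lorentz N N = ((A s)\<^sup>2 + (B s)\<^sup>2) * ((z s)\<^sup>2 - 1)"
      unfolding r by (simp add: power2_eq_square algebra_simps)
    then have "lorentz N N = 1" by (simp add: AB \<zeta>)
    moreover have "lorentz (vderiv \<gamma> s) N = A s * B s * ((z s)\<^sup>2 - 1) * ((z s)\<^sup>2 - 1 - ((X s)\<^sup>2 + (Y s)\<^sup>2))"
      by (simp add: N_def Ts lorentz_def power2_eq_square algebra_simps)
    then have "lorentz (vderiv \<gamma> s) N = 0" by (simp add: r)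
    moreover have "det (vector [\<gamma> s, vderiv \<gamma> s, N] :: real^3^3) =
        ((A s)\<^sup>2 + (B s)\<^sup>2) * ((X s)\<^sup>2 + (Y s)\<^sup>2) * ((z s)\<^sup>2 - ((z s)\<^sup>2 - 1))"
      unfolding det_3 by (simp add: N_def Ts \<gamma>s power2_eq_square algebra_simps)
    then have "det (vector [\<gamma> s, vderiv \<gamma> s, N] :: real^3^3) = 1"
      by (simp add: r AB \<zeta>)
    ultimately show ?thesis
      by (simp add: is_unit_normal_def tangent_plane_def pos_oriented_def)
  qed
  then have N: "unit_normal \<gamma> s = N"
    using unit_speed_curve_frame(1)[OF us] by metis
  have dT: "vderiv (vderiv \<gamma>) s = \<gamma> s + \<kappa> s *\<^sub>R N"
  proof -
    define dA where "dA s = \<zeta> s * z s - \<kappa> s * B s - 2 * z s * (A s)\<^sup>2" for s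
    define dB where "dB s = A s * (\<kappa> s - 2 * z s * B s)" for s
    define dX where "dX s = A s * z s * X s - B s * Y s" for s
    define dY where "dY s = A s * z s * Y s + B s * X s" for s
    define dz where "dz s = A s * ((z s)\<^sup>2 - 1)" for s
    note d = X[folded dX_def] Y[folded dY_def] z[folded dz_def] A[folded dA_def] B[folded dB_def]
    note defs = dA_def dB_def dX_def dY_def dz_def
    have "vderiv (vderiv \<gamma>) = (\<lambda>s. point
        (dA s * (z s * X s) + A s * (dz s * X s + z s * dX s) - (dB s * Y s + B s * dY s))
        (dA s * (z s * Y s) + A s * (dz s * Y s + z s * dY s) + (dB s * X s + B s * dX s))
        (dA s * ((z s)\<^sup>2 - 1) + A s * (2 * z s * dz s)))"
      unfolding T
      by (rule point_vderiv(2)) (auto intro!: derivative_eq_intros d simp: algebra_simps)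
    then have "vderiv (vderiv \<gamma>) s = point
        (dA s * (z s * X s) + A s * (dz s * X s + z s * dX s) - (dB s * Y s + B s * dY s))
        (dA s * (z s * Y s) + A s * (dz s * Y s + z s * dY s) + (dB s * X s + B s * dX s))
        (dA s * ((z s)\<^sup>2 - 1) + A s * (2 * z s * dz s))"
      by metis
    moreover have "dA s * (z s * X s) + A s * (dz s * X s + z s * dX s) - (dB s * Y s + B s * dY s)
      = X s + \<kappa> s * (- B s * z s * X s - A s * Y s)
        + X s * ((\<zeta> s * ((z s)\<^sup>2 - 1) - 1) + (\<zeta> s - ((A s)\<^sup>2 + (B s)\<^sup>2)))"
      unfolding defs by (simp add: power2_eq_square algebra_simps)
    moreover have "dA s * (z s * Y s) + A s * (dz s * Y s + z s * dY s) + (dB s * X s + B s * dX s)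
      = Y s + \<kappa> s * (- B s * z s * Y s + A s * X s)
        + Y s * ((\<zeta> s * ((z s)\<^sup>2 - 1) - 1) + (\<zeta> s - ((A s)\<^sup>2 + (B s)\<^sup>2)))"
      unfolding defs by (simp add: power2_eq_square algebra_simps)
    moreover have "dA s * ((z s)\<^sup>2 - 1) + A s * (2 * z s * dz s)
      = z s + \<kappa> s * (- B s * ((z s)\<^sup>2 - 1)) + z s * (\<zeta> s * ((z s)\<^sup>2 - 1) - 1)"
      unfolding defs by (simp add: power2_eq_square algebra_simps)
    ultimately show ?thesis
      by (simp add: vec_eq_iff forall_3 \<gamma>s N_def \<zeta> AB)
  qed
  have "lorentz (\<gamma> s + \<kappa> s *\<^sub>R N) (\<gamma> s) = lorentz (\<gamma> s) (\<gamma> s) + \<kappa> s * lorentz N (\<gamma> s)"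
    by (simp add: lorentz_def algebra_simps)
  moreover have "lorentz N (\<gamma> s) = 0"
    using \<open>is_unit_normal (\<gamma> s) (vderiv \<gamma> s) N\<close> by (simp add: is_unit_normal_def tangent_plane_def)
  ultimately have "covariant_deriv \<gamma> (vderiv \<gamma>) s = \<kappa> s *\<^sub>R unit_normal \<gamma> s"
    by (simp add: covariant_deriv_def tangent_part_def dT hyp N)
  then show "geodesic_curvature \<gamma> s = \<kappa> s"
    using unit_speed_curve_frame(2)[OF us] by metis
qed

text \<open>A set of functions whose derivatives are polynomials in members of the set generates an algebra that is
closed under differentiation. This turns a polynomial system of differential equations into the smoothness of its
solutions.\<close>

inductive_set generated_algebra :: "(real \<Rightarrow> real) set \<Rightarrow> (real \<Rightarrow> real) set"
  for G :: "(real \<Rightarrow> real) set" where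
  generator: "f \<in> G \<Longrightarrow> f \<in> generated_algebra G"
| const: "(\<lambda>s. k) \<in> generated_algebra G"
| sum: "f \<in> generated_algebra G \<Longrightarrow> g \<in> generated_algebra G \<Longrightarrow> (\<lambda>s. f s + g s) \<in> generated_algebra G"
| product: "f \<in> generated_algebra G \<Longrightarrow> g \<in> generated_algebra G \<Longrightarrow> (\<lambda>s. f s * g s) \<in> generated_algebra G"

lemma generated_algebra_derivative:
  assumes G: "\<And>f. f \<in> G \<Longrightarrow> \<exists>f'\<in>generated_algebra G. \<forall>s. (f has_real_derivative f' s) (at s)"
    and "f \<in> generated_algebra G"
  shows "\<exists>f'\<in>generated_algebra G. \<forall>s. (f has_real_derivative f' s) (at s)"
  using assms(2)
proof induction
  case (generator f)
  then show ?case by (rule G)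
next
  case (const k)
  show ?case
    by (rule bexI[of _ "\<lambda>s. 0"]) (auto intro: generated_algebra.const)
next
  case (sum f g)
  then obtain f' g' where "f' \<in> generated_algebra G" "\<forall>s. (f has_real_derivative f' s) (at s)"
    "g' \<in> generated_algebra G" "\<forall>s. (g has_real_derivative g' s) (at s)" by blast
  then show ?case
    by (intro bexI[of _ "\<lambda>s. f' s + g' s"] generated_algebra.sum) (auto intro!: DERIV_add)
next
  case (product f g)
  then obtain f' g' where "f' \<in> generated_algebra G" "\<forall>s. (f has_real_derivative f' s) (at s)"
    "g' \<in> generated_algebra G" "\<forall>s. (g has_real_derivative g' s) (at s)" by blast
  with product.hyps show ?case
    by (intro bexI[of _ "\<lambda>s. f' s * g s + g' s * f s"] generated_algebra.sum generated_algebra.product)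
       (auto intro!: DERIV_mult)
qed


section \<open>p-elastic curves from orbits\<close>

lemma real_pow_eq_powr: "k > 0 \<Longrightarrow> real_pow k a = k powr a"
  by (auto simp: real_pow_def Ints_def powr_real_of_int')

text \<open>With \<open>A = z\<^sup>n v \<zeta>\<close>, \<open>B = c z\<^sup>n \<zeta>\<close> and \<open>\<kappa> = n c z\<^sup>n\<^sup>-\<^sup>1\<close> the frame equations follow from the profile equations.
By \<open>(n - 1) (p - 1) = 1\<close> the power \<open>\<kappa>\<^sup>p\<^sup>-\<^sup>1\<close> is a constant multiple of \<open>z\<close>, and the equation of \<open>p\<close>-elastic
curves becomes \<open>z'' = z - n c\<^sup>2 z\<^sup>2\<^sup>n\<^sup>-\<^sup>1\<close>, which is the energy equation \<open>z'\<^sup>2 = z\<^sup>2 - 1 - c\<^sup>2 z\<^sup>2\<^sup>n\<close> differentiated.\<close>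

lemma elastic_curve_from_profile:
  fixes p n c :: real and x v \<theta> :: "real \<Rightarrow> real"
  defines "\<gamma> \<equiv> \<lambda>s. point (sqrt (exp (2 * x s) - 1) * cos (\<theta> s)) (sqrt (exp (2 * x s) - 1) * sin (\<theta> s))
      (exp (x s))"
  assumes p: "p > 1" and n: "n = p / (p - 1)" and c: "c > 0" and x_pos: "\<And>s. x s > 0"
    and x': "\<And>s. (x has_real_derivative exp ((n - 1) * x s) * v s) (at s)"
    and v': "\<And>s. (v has_real_derivative exp (- (n + 1) * x s) * (n - (n - 1) * exp (2 * x s))) (at s)"
    and \<theta>': "\<And>s. (\<theta> has_real_derivative c * exp (n * x s) / (exp (2 * x s) - 1)) (at s)"
    and energy: "\<And>s. (v s)\<^sup>2 = exp (- 2 * (n - 1) * x s) - exp (- 2 * n * x s) - c\<^sup>2"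
  shows "p_elastic_curve p \<gamma>" and "geodesic_curvature \<gamma> s = n * c * exp ((n - 1) * x s)"
proof -
  have n1: "n > 1" "(n - 1) * (p - 1) = 1" "(p - 1) * n = p"
  proof -
    show "n > 1" using p by (simp add: n)
    show "(p - 1) * n = p" using p by (simp add: n)
    then show "(n - 1) * (p - 1) = 1" by (simp add: algebra_simps)
  qed
  define z where "z s = exp (x s)" for s
  define E where "E s = exp (n * x s)" for s
  define \<zeta> where "\<zeta> s = 1 / (exp (2 * x s) - 1)" for s
  define X where "X s = sqrt (exp (2 * x s) - 1) * cos (\<theta> s)" for s
  define Y where "Y s = sqrt (exp (2 * x s) - 1) * sin (\<theta> s)" for s
  define A where "A s = E s * v s * \<zeta> s" for s
  define B where "B s = c * E s * \<zeta> s" for s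
  define \<kappa> where "\<kappa> s = n * c * exp ((n - 1) * x s)" for s
  have pos: "z s > 0" "E s > 0" for s by (simp_all add: z_def E_def)
  have zz: "exp (2 * x s) = (z s)\<^sup>2" for s by (simp add: z_def exp_double)
  have Ez: "exp ((n - 1) * x s) = E s / z s" for s
    by (simp add: z_def E_def algebra_simps exp_diff)
  have z_gt: "z s > 1" for s by (simp add: z_def x_pos)
  have z2: "(z s)\<^sup>2 - 1 > 0" for s using one_less_power[OF z_gt[of s], of 2] by simp
  have \<zeta>: "\<zeta> s * ((z s)\<^sup>2 - 1) = 1" for s using z2[of s] by (simp add: \<zeta>_def zz)
  have x1: "(x has_real_derivative E s / z s * v s) (at s)" for s using x' by (simp add: Ez)
  have exp1: "((\<lambda>t. exp (k * x t)) has_real_derivative exp (k * x s) * (k * (E s / z s * v s))) (at s)" for k s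
    by (rule DERIV_chain2[OF DERIV_exp DERIV_cmult[OF x1]])
  have z1: "(z has_real_derivative E s * v s) (at s)" for s
    using exp1[of 1 s] by (simp add: z_def[abs_def])
  have E1: "(E has_real_derivative n * (E s)\<^sup>2 * v s / z s) (at s)" for s
    using exp1[of n s] by (simp add: E_def[abs_def] power2_eq_square mult_ac)
  have v1: "(v has_real_derivative (n - (n - 1) * (z s)\<^sup>2) / (E s * z s)) (at s)" for s
  proof -
    have "exp (- (n + 1) * x s) * (E s * z s) = 1"
      by (simp add: z_def E_def algebra_simps flip: exp_add)
    then have "exp (- (n + 1) * x s) = 1 / (E s * z s)"
      using pos[of s] by (simp add: eq_divide_eq)
    then show ?thesis using v'[of s] by (simp add: zz)
  qed
  have \<zeta>1: "(\<zeta> has_real_derivative - 2 * z s * (E s * v s) * (\<zeta> s)\<^sup>2) (at s)" for s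
  proof -
    have "((\<lambda>s. 1 / ((z s)\<^sup>2 - 1)) has_real_derivative - 2 * z s * (E s * v s) * (1 / ((z s)\<^sup>2 - 1))\<^sup>2) (at s)"
      using z2[of s] by (auto intro!: derivative_eq_intros z1 simp: power2_eq_square divide_simps)
    then show ?thesis by (simp add: \<zeta>_def[abs_def] zz)
  qed
  have en: "(E s)\<^sup>2 * ((v s)\<^sup>2 + c\<^sup>2) = (z s)\<^sup>2 - 1" for s
  proof -
    have "(E s)\<^sup>2 = exp (2 * n * x s)" "(z s)\<^sup>2 = exp (2 * x s)"
      by (simp_all add: E_def z_def mult.assoc flip: exp_double)
    then show ?thesis
      unfolding energy by (simp add: algebra_simps flip: exp_add)
  qed
  have X1: "(X has_real_derivative A s * z s * X s - B s * Y s) (at s)"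
    and Y1: "(Y has_real_derivative A s * z s * Y s + B s * X s) (at s)" for s
  proof -
    define r where "r s = sqrt ((z s)\<^sup>2 - 1)" for s
    have r_pos: "r s > 0" using z2 by (simp add: r_def)
    have r2: "r s * r s * \<zeta> s = 1" using z2[of s] \<zeta>[of s] by (simp add: r_def mult.commute)
    have "(r has_real_derivative z s * (E s * v s) / r s) (at s)"
      unfolding r_def[abs_def] using z2[of s]
      by (auto intro!: derivative_eq_intros z1 simp: field_simps)
    moreover have "z s * (E s * v s) / r s = A s * z s * r s"
    proof -
      have "z s * (E s * v s) / r s = z s * (E s * v s) * (r s * r s * \<zeta> s) / r s" by (simp add: r2)
      also have "\<dots> = A s * z s * r s" using r_pos by (simp add: A_def)
      finally show ?thesis .
    qed
    ultimately have r1: "(r has_real_derivative A s * z s * r s) (at s)" by simp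
    have t1: "(\<theta> has_real_derivative B s) (at s)" using \<theta>'[of s] by (simp add: B_def E_def \<zeta>_def)
    have XY: "X = (\<lambda>s. r s * cos (\<theta> s))" "Y = (\<lambda>s. r s * sin (\<theta> s))"
      by (simp_all add: X_def[abs_def] Y_def[abs_def] r_def zz)
    show "(X has_real_derivative A s * z s * X s - B s * Y s) (at s)"
      using DERIV_mult[OF r1 DERIV_chain2[OF DERIV_cos t1]]
      by (simp add: XY algebra_simps)
    show "(Y has_real_derivative A s * z s * Y s + B s * X s) (at s)"
      using DERIV_mult[OF r1 DERIV_chain2[OF DERIV_sin t1]]
      by (simp add: XY algebra_simps)
  qed
  \<comment> \<open>Both the second derivative of \<open>z\<close> and a term of the derivative of \<open>A\<close>.\<close>
  have z_second: "n * (E s)\<^sup>2 * v s / z s * v s + (n - (n - 1) * (z s)\<^sup>2) / (E s * z s) * E s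
      = z s - n * c\<^sup>2 * (E s)\<^sup>2 / z s" for s
  proof -
    have "n * (E s)\<^sup>2 * v s / z s * v s + (n - (n - 1) * (z s)\<^sup>2) / (E s * z s) * E s
        = (n * ((E s)\<^sup>2 * ((v s)\<^sup>2 + c\<^sup>2)) + n - (n - 1) * (z s)\<^sup>2 - n * c\<^sup>2 * (E s)\<^sup>2) / z s"
      using pos[of s] by (simp add: field_simps power2_eq_square)
    also have "\<dots> = ((z s)\<^sup>2 - n * c\<^sup>2 * (E s)\<^sup>2) / z s"
      unfolding en by (simp add: algebra_simps)
    finally show ?thesis using pos[of s] by (simp add: field_simps power2_eq_square)
  qed
  have \<kappa>E: "\<kappa> s = n * c * (E s / z s)" for s by (simp only: \<kappa>_def Ez)
  have A1: "(A has_real_derivative \<zeta> s * z s - \<kappa> s * B s - 2 * z s * (A s)\<^sup>2) (at s)" for s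
  proof -
    have "(A has_real_derivative (n * (E s)\<^sup>2 * v s / z s * v s + (n - (n - 1) * (z s)\<^sup>2) / (E s * z s) * E s) * \<zeta> s
        + (- 2 * z s * (E s * v s) * (\<zeta> s)\<^sup>2) * (E s * v s)) (at s)"
      unfolding A_def[abs_def] by (intro DERIV_mult E1 v1 \<zeta>1)
    moreover note z_second
    moreover have "(z s - n * c\<^sup>2 * (E s)\<^sup>2 / z s) * \<zeta> s + (- 2 * z s * (E s * v s) * (\<zeta> s)\<^sup>2) * (E s * v s)
        = \<zeta> s * z s - \<kappa> s * B s - 2 * z s * (A s)\<^sup>2"
      by (simp add: A_def B_def \<kappa>E power2_eq_square algebra_simps)
    ultimately show ?thesis by metis
  qed
  have B1: "(B has_real_derivative A s * (\<kappa> s - 2 * z s * B s)) (at s)" for s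
  proof -
    have "(B has_real_derivative c * (n * (E s)\<^sup>2 * v s / z s) * \<zeta> s
        + (- 2 * z s * (E s * v s) * (\<zeta> s)\<^sup>2) * (c * E s)) (at s)"
      unfolding B_def[abs_def] by (intro DERIV_mult DERIV_cmult E1 \<zeta>1)
    then show ?thesis
      by (rule DERIV_cong) (simp add: A_def B_def \<kappa>E power2_eq_square algebra_simps)
  qed
  define G where "G = range (\<lambda>k s. exp (k * x s)) \<union> {v, \<zeta>, X, Y}"
  note alg = generated_algebra.generator generated_algebra.const generated_algebra.sum
    generated_algebra.product
  have gen: "(\<lambda>s. exp (k * x s)) \<in> generated_algebra G" "v \<in> generated_algebra G"
    "\<zeta> \<in> generated_algebra G" "X \<in> generated_algebra G" "Y \<in> generated_algebra G" for k
    by (auto intro!: generated_algebra.generator simp: G_def)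
  have gen': "E \<in> generated_algebra G" "z \<in> generated_algebra G"
    using gen(1)[of n] gen(1)[of 1] by (simp_all add: E_def[abs_def] z_def[abs_def])
  have AB_gen: "A \<in> generated_algebra G" "B \<in> generated_algebra G"
    unfolding A_def[abs_def] B_def[abs_def] by (intro alg(2-4) gen gen')+
  have minus: "(\<lambda>s. - f s) \<in> generated_algebra G" if "f \<in> generated_algebra G" for f
    using generated_algebra.product[OF generated_algebra.const[of "- 1"] that] by simp
  have G: "\<exists>f'\<in>generated_algebra G. \<forall>s. (f has_real_derivative f' s) (at s)" if "f \<in> G" for f
  proof -
    consider k where "f = (\<lambda>s. exp (k * x s))" | "f = v" | "f = \<zeta>" | "f = X" | "f = Y"
      using \<open>f \<in> G\<close> by (auto simp: G_def)
    then show ?thesis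
    proof cases
      case 1
      show ?thesis
      proof (intro bexI[of _ "\<lambda>s. exp (k * x s) * (k * (exp ((n - 1) * x s) * v s))"] allI)
        show "(f has_real_derivative exp (k * x s) * (k * (exp ((n - 1) * x s) * v s))) (at s)" for s
          unfolding 1 using exp1[of k s] by (simp add: Ez)
      qed (intro alg(2-4) gen)
    next
      case 2
      show ?thesis
      proof (intro bexI[of _ "\<lambda>s. exp (- (n + 1) * x s) * (n + (- (n - 1)) * exp (2 * x s))"] allI)
        show "(f has_real_derivative exp (- (n + 1) * x s) * (n + (- (n - 1)) * exp (2 * x s))) (at s)" for s
          unfolding 2 by (rule DERIV_cong[OF v']) (simp add: algebra_simps)
      qed (intro alg(2-4) gen)
    next
      case 3
      show ?thesis
      proof (intro bexI[of _ "\<lambda>s. - 2 * z s * (E s * v s) * (\<zeta> s * \<zeta> s)"] allI)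
        show "(f has_real_derivative - 2 * z s * (E s * v s) * (\<zeta> s * \<zeta> s)) (at s)" for s
          unfolding 3 by (rule DERIV_cong[OF \<zeta>1]) (simp add: power2_eq_square)
      qed (intro alg(2-4) gen gen')
    next
      case 4
      show ?thesis
      proof (intro bexI[of _ "\<lambda>s. A s * z s * X s + - (B s * Y s)"] allI)
        show "(f has_real_derivative A s * z s * X s + - (B s * Y s)) (at s)" for s
          unfolding 4 by (rule DERIV_cong[OF X1]) simp
      qed (intro alg(3-4) minus gen gen' AB_gen)
    next
      case 5
      show ?thesis
      proof (intro bexI[of _ "\<lambda>s. A s * z s * Y s + B s * X s"] allI)
        show "(f has_real_derivative A s * z s * Y s + B s * X s) (at s)" for s
          unfolding 5 by (rule Y1)
      qed (intro alg(3-4) gen gen' AB_gen)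
    qed
  qed
  have \<gamma>: "\<gamma> = (\<lambda>s. point (X s) (Y s) (z s))"
    by (simp add: \<gamma>_def X_def Y_def z_def)
  have smooth: "smooth_curve (\<lambda>s. point (X s) (Y s) (z s))"
    by (rule smooth_curve_point[OF generated_algebra_derivative[OF G]]) (use gen gen' in auto)
  have zd: "(z has_real_derivative A s * ((z s)\<^sup>2 - 1)) (at s)" for s
    by (rule DERIV_cong[OF z1]) (use \<zeta>[of s] in \<open>simp add: A_def mult.assoc\<close>)
  have r: "(X s)\<^sup>2 + (Y s)\<^sup>2 = (z s)\<^sup>2 - 1" for s
  proof -
    have "(X s)\<^sup>2 + (Y s)\<^sup>2 = (sqrt ((z s)\<^sup>2 - 1))\<^sup>2 * ((cos (\<theta> s))\<^sup>2 + (sin (\<theta> s))\<^sup>2)"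
      unfolding X_def Y_def zz power_mult_distrib by (rule distrib_left[symmetric])
    then show ?thesis using z2[of s] by simp
  qed
  have AB: "(A s)\<^sup>2 + (B s)\<^sup>2 = \<zeta> s" for s
  proof -
    have "(A s)\<^sup>2 + (B s)\<^sup>2 = (E s)\<^sup>2 * ((v s)\<^sup>2 + c\<^sup>2) * (\<zeta> s)\<^sup>2"
      by (simp add: A_def B_def power_mult_distrib algebra_simps)
    then show ?thesis unfolding en using \<zeta>[of s] by (simp add: power2_eq_square mult.commute)
  qed
  note curve = curve_from_frame_equations[OF smooth X1 Y1 zd A1 B1 z_gt r \<zeta> AB, folded \<gamma>]
  show curvature: "geodesic_curvature \<gamma> s = n * c * exp ((n - 1) * x s)" for s
    using curve(2)[of s] by (simp add: \<kappa>_def)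
  have \<kappa>_pos: "n * c * exp ((n - 1) * x s) > 0" for s using n1 c by simp
  define C where "C = (n * c) powr (p - 1)"
  have pow: "real_pow (n * c * exp ((n - 1) * x s)) (p - 1) = C * z s" for s
  proof -
    have "exp ((n - 1) * x s) powr (p - 1) = exp (((n - 1) * (p - 1)) * x s)"
      by (simp add: powr_def mult_ac)
    then show ?thesis
      unfolding real_pow_eq_powr[OF \<kappa>_pos] using n1 c by (simp add: powr_mult C_def z_def)
  qed
  have pow': "real_pow (n * c * exp ((n - 1) * x s)) (p + 1) = C * z s * (n * c * E s / z s)\<^sup>2" for s
  proof -
    have "(n * c * exp ((n - 1) * x s)) powr (p + 1)
        = (n * c * exp ((n - 1) * x s)) powr ((p - 1) + 2)" by (simp add: algebra_simps)
    also have "\<dots> = (n * c * exp ((n - 1) * x s)) powr (p - 1) * (n * c * exp ((n - 1) * x s))\<^sup>2"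
      unfolding powr_add using \<kappa>_pos[of s] by simp
    finally show ?thesis
      using pow[of s] unfolding real_pow_eq_powr[OF \<kappa>_pos] by (simp add: Ez)
  qed
  have d2: "(deriv ^^ 2) (\<lambda>t. C * z t) s = C * (z s - n * c\<^sup>2 * (E s)\<^sup>2 / z s)" for s
  proof -
    have "deriv (\<lambda>t. C * z t) = (\<lambda>t. C * (E t * v t))"
      by (intro ext DERIV_imp_deriv DERIV_cmult z1)
    moreover have "deriv (\<lambda>t. C * (E t * v t)) s = C * (n * (E s)\<^sup>2 * v s / z s * v s + (n - (n - 1) * (z s)\<^sup>2) / (E s * z s) * E s)"
      by (intro DERIV_imp_deriv DERIV_cmult DERIV_mult E1 v1)
    moreover have "(deriv ^^ 2) (\<lambda>t. C * z t) s = deriv (deriv (\<lambda>t. C * z t)) s"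
      by (simp add: numeral_2_eq_2)
    ultimately show ?thesis unfolding z_second by simp
  qed
  show "p_elastic_curve p \<gamma>"
    unfolding p_elastic_curve_def curvature pow pow' d2
  proof (intro conjI allI impI)
    show "unit_speed_curve \<gamma>" by (rule curve(1))
    show "n * c * exp ((n - 1) * x s) > 0" for s by (rule \<kappa>_pos)
    show "p * (C * (z s - n * c\<^sup>2 * (E s)\<^sup>2 / z s)) + (p - 1) * (C * z s * (n * c * E s / z s)\<^sup>2)
        - p * (C * z s) = 0" for s
    proof -
      have "p * (C * (z s - n * c\<^sup>2 * (E s)\<^sup>2 / z s)) + (p - 1) * (C * z s * (n * c * E s / z s)\<^sup>2)
          - p * (C * z s) = ((p - 1) * n - p) * (C * n * c\<^sup>2 * (E s)\<^sup>2 / z s)"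
        using pos[of s] by (simp add: power2_eq_square field_simps)
      then show ?thesis by (simp add: n1)
    qed
  qed
qed

theorem theorem5p2:
  fixes p q :: real
  assumes "p > 1" and "q \<in> \<rat>" and "1 < 2 * q" and "2 * q < sqrt 2"
  shows "\<exists>\<gamma>. p_elastic_curve p \<gamma> \<and> closed_curve \<gamma> \<and>
    \<not> (\<exists>c. \<forall>s. geodesic_curvature \<gamma> s = c)"
proof -
  define n where "n = p / (p - 1)"
  have n: "n > 1" using assms(1) by (simp add: n_def)
  interpret height_potential n by unfold_locales (rule n)
  obtain \<rho> where \<rho>: "0 < \<rho>" "\<rho> < a" "\<Lambda> \<rho> = 2 * pi * q"
    using \<Lambda>_attains[OF assms(3,4)] by blast
  define c where "c = sqrt (a\<^sup>2 - \<rho>\<^sup>2)"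
  have c: "c > 0" "c\<^sup>2 = a\<^sup>2 - \<rho>\<^sup>2"
    using \<rho> power_strict_mono[of \<rho> a 2] by (simp_all add: c_def)
  obtain x v \<theta> :: "real \<Rightarrow> real" and L where o:
    "\<And>s. x s > 0"
    "\<And>s. (x has_real_derivative exp ((n - 1) * x s) * v s) (at s)"
    "\<And>s. (v has_real_derivative exp (- (n + 1) * x s) * (n - (n - 1) * exp (2 * x s))) (at s)"
    "\<And>s. (\<theta> has_real_derivative c * exp (n * x s) / (exp (2 * x s) - 1)) (at s)"
    "\<And>s. (v s)\<^sup>2 = W (x s) - (a\<^sup>2 - \<rho>\<^sup>2)"
    and L: "L > 0" "\<And>s. x (s + L) = x s" "\<And>s. \<theta> (s + L) = \<theta> s + \<Lambda> \<rho>"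
    and nc: "\<exists>s t. x s \<noteq> x t"
    by (rule orbit[OF \<rho>(1,2), folded c_def]) (rule that, assumption+)
  define \<gamma> where "\<gamma> s = point (sqrt (exp (2 * x s) - 1) * cos (\<theta> s))
      (sqrt (exp (2 * x s) - 1) * sin (\<theta> s)) (exp (x s))" for s
  have energy: "(v s)\<^sup>2 = exp (- 2 * (n - 1) * x s) - exp (- 2 * n * x s) - c\<^sup>2" for s
    using o(5)[of s] by (simp add: W_def c)
  note curve = elastic_curve_from_profile[OF assms(1) n_def c(1) o(1-4) energy, folded \<gamma>_def[abs_def]]
  have "closed_curve \<gamma>"
  proof -
    \<comment> \<open>After \<open>j\<close> periods the polar angle has grown by \<open>2 \<pi> i\<close>.\<close>
    obtain i :: int and j :: nat where ij: "q = of_int i / of_nat j" "j \<noteq> 0"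
      using assms(2) by (auto simp: Rats_eq_int_div_nat)
    have x_per: "x (s + of_nat k * L) = x s" and \<theta>_per: "\<theta> (s + of_nat k * L) = \<theta> s + of_nat k * \<Lambda> \<rho>" for s k
    proof (induction k)
      case (Suc k)
      have e: "s + of_nat (Suc k) * L = s + of_nat k * L + L" by (simp add: algebra_simps)
      { case 1 show ?case unfolding e using Suc by (simp add: L) }
      { case 2 show ?case unfolding e L(3) using Suc by (simp add: algebra_simps) }
    qed simp_all
    have "of_nat j * \<Lambda> \<rho> = 2 * pi * of_int i" using ij \<rho>(3) by simp
    then have "\<gamma> (s + of_nat j * L) = \<gamma> s" for s
      by (simp add: \<gamma>_def x_per \<theta>_per cos_add sin_add)
    moreover have "of_nat j * L > 0" using ij L by simp
    ultimately show ?thesis unfolding closed_curve_def by blast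
  qed
  moreover have "\<not> (\<exists>k. \<forall>s. geodesic_curvature \<gamma> s = k)"
  proof
    assume "\<exists>k. \<forall>s. geodesic_curvature \<gamma> s = k"
    then have "n * c * exp ((n - 1) * x s) = n * c * exp ((n - 1) * x t)" for s t
      unfolding curve(2) by metis
    then have "x s = x t" for s t using n c(1) by simp
    with nc show False by blast
  qed
  ultimately show ?thesis using curve(1) by blast
qed

end
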